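(* Let $A=\bigoplus_{n\ge0}A_n$ be an $\mathbb N$-graded $H$-algebra (with $\mathbb N=\mathbb Z_{\ge0}$). Then the inclusion $A_0\to A$ is a $kk$-equivalence.
   Context: **Algebras.** $H$ is a fixed unital, not necessarily commutative ring. An $H$-algebra is a monoid, possibly without unit, in $H$-bimodules with $\otimes_H$; $\mathrm{Alg}_H$ is a fixed choice of either the category of all $H$-algebras or, if $H$ is commutative, that of central ones ($ha=ah$). $\mathfrak U$ is a fixed underlying category: sets, abelian groups, or $H$-bimodules (central ones in the central case); $F:\mathrm{Alg}_H\to\mathfrak U$ is the forgetful functor, $\tilde T$ its left adjoint, $T=\tilde T\circ F$. For a ring $L$, $LA=AL=L\otimes_{\mathbb Z}A$. An extension is a sequence $A\xrightarrow{f}B\xrightarrow{g}C$ in which $f$ is a kernel of $g$ and $g$ a cokernel of $f$; it is $F$-split if $F(g)$ has a section in $\mathfrak U$. **Homotopy.** Functors on algebras are extended levelwise to ind-algebras (directed diagrams of algebras, with $\mathrm{Hom}((X_i),(Y_j))=\lim_i\mathrm{colim}_j\mathrm{Hom}(X_i,Y_j)$), and ind-ind-algebras are collapsed to ind-algebras. $A^\Delta$ is the simplicial algebra $[n]\mapsto A\otimes_{\mathbb Z}\mathbb Z[t_0,\dots,t_n]/\langle 1-\sum t_i\rangle$. For a simplicial set $K$, $A^K=\mathrm{map}(K,A^\Delta)$ (simplicial maps); for a pointed one, $A^{(K,\star)}=\ker(A^K\to A)$ (evaluation at $\star$). Thus $A^{\Delta^1}=A[t]$. Put $S^1=\Delta^1/\partial\Delta^1$,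 $\Omega A=A^{(S^1,\star)}=\{p\in A[t]:p(0)=p(1)=0\}$, $PA=A^{(\Delta^1,\star)}=\{p\in A[t]:p(0)=0\}$, $\mathrm{ev}_1:PA\to A$ evaluation at $1$. Homomorphisms $f,g:A\to B$ are elementary homotopic if there is $h:A\to B[t]$ with $\mathrm{ev}_0h=f$, $\mathrm{ev}_1h=g$; homotopic if joined by a chain of elementary homotopies; $[A,B]$ is the set of homotopy classes, and for ind-algebras $[(A_i),(B_j)]=\lim_i\mathrm{colim}_j[A_i,B_j]$. With $\mathrm{sd}$ the simplicial subdivision and last vertex maps $\mathrm{sd}K\to K$, let $A^{\mathcal S^1}$ be the ind-algebra $\{A^{(\mathrm{sd}^pS^1,\star)}\}_{p\ge0}$, $A^{\mathcal S^0}=A$, $A^{\mathcal S^{n+1}}=(A^{\mathcal S^n})^{\mathcal S^1}$. $M_\infty=\bigcup_nM_n(\mathbb Z)$, $M_\bullet$ is the ind-ring $(M_n(\mathbb Z))_n$ (upper left corner inclusions), $\mathcal M_\infty=M_\bullet\otimes M_\infty$, and $\{A,B\}=[A,\mathcal M_\infty B]$. **Definition of $kk$.** $J(A)=\ker(T(A)\to A)$ (counit). For an $F$-split extension $A\to B\xrightarrow{g} C$, a section of $F(g)$ induces $T(C)\to B$, restricting to the classifying map $J(C)\to A$, unique up to elementary homotopy. $\rho_A:J(A)\to\Omega A$ is the classifying map of $\Omega A\to PA\xrightarrow{\mathrm{ev}_1}A$ (section $a\mapsto ta$); its composite with $\Omega A\to A^{\mathcal S^1}$ is also denoted $\rho_A$.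 For $L$ a ring that is free as an abelian group, the classifying map of $LJ(A)\to LT(A)\to LA$ is a map $J(LA)\to LJ(A)$; applied levelwise this gives $\gamma:J(A^{\mathcal S^1})\to J(A)^{\mathcal S^1}$ and $J(\mathcal M_\infty A)\to\mathcal M_\infty J(A)$, so that $J$ induces maps $\{A,B\}\to\{J(A),J(B)\}$. For $H$-algebras $A,B$, $$kk(A,B)=\mathrm{colim}_n\{J^n(A),B^{\mathcal S^n}\},$$ with transition maps $f\mapsto\rho_{B^{\mathcal S^n}}\circ J(f)$; it is an abelian group (concatenation of loops, equivalently block sum of matrices). The product of the classes of $\alpha:J^n(B)\to C^{\mathcal S^n}$ and $\beta:J^m(A)\to B^{\mathcal S^m}$ is $(-1)^{mn}$ times the class of $J^{n+m}(A)\xrightarrow{J^n(\beta)}J^n(B^{\mathcal S^m})\xrightarrow{\gamma}J^n(B)^{\mathcal S^m}\xrightarrow{\alpha^{\mathcal S^m}}C^{\mathcal S^{n+m}}$, matrix factors being combined by tensor product of matrices $\mathcal M_\infty\otimes\mathcal M_\infty\to\mathcal M_\infty$. $kk$ is the resulting category with the objects of $\mathrm{Alg}_H$, and $j:\mathrm{Alg}_H\to kk$ is the identity on objects and sends a homomorphism to its class. A homomorphism $f$ is a $kk$-equivalence if $j(f)$ is an isomorphism in $kk$. *)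

theory Defs
  imports "HOL-Algebra.Module" "HOL-Library.Nat_Bijection"
begin

section \<open>Algebras over a ring\<close>

text \<open>
  An algebra is a possibly non-unital monoid in bimodules over \<open>H\<close>. As in the record
  \<^type>\<open>module\<close> of the library, the record extends \<^type>\<open>ring\<close> although not all
  of its fields carry meaning: the field \<open>one\<close> is never used.
\<close>

record ('h, 'u) halgebra = "'u ring" +
  lact :: "'h \<Rightarrow> 'u \<Rightarrow> 'u"
  ract :: "'u \<Rightarrow> 'h \<Rightarrow> 'u"

locale halgebra = H: ring H + A: abelian_group A
  for H :: "('h, 'm) ring_scheme" (structure) and A :: "('h, 'u, 'n) halgebra_scheme" (structure) +
  assumes mult_closed: "\<lbrakk>x \<in> carrier A; y \<in> carrier A\<rbrakk> \<Longrightarrow> x \<otimes>\<^bsub>A\<^esub> y \<in> carrier A"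
    and mult_assoc: "\<lbrakk>x \<in> carrier A; y \<in> carrier A; z \<in> carrier A\<rbrakk>
      \<Longrightarrow> (x \<otimes>\<^bsub>A\<^esub> y) \<otimes>\<^bsub>A\<^esub> z = x \<otimes>\<^bsub>A\<^esub> (y \<otimes>\<^bsub>A\<^esub> z)"
    and l_distr: "\<lbrakk>x \<in> carrier A; y \<in> carrier A; z \<in> carrier A\<rbrakk>
      \<Longrightarrow> (x \<oplus>\<^bsub>A\<^esub> y) \<otimes>\<^bsub>A\<^esub> z = x \<otimes>\<^bsub>A\<^esub> z \<oplus>\<^bsub>A\<^esub> y \<otimes>\<^bsub>A\<^esub> z"
    and r_distr: "\<lbrakk>x \<in> carrier A; y \<in> carrier A; z \<in> carrier A\<rbrakk>
      \<Longrightarrow> x \<otimes>\<^bsub>A\<^esub> (y \<oplus>\<^bsub>A\<^esub> z) = x \<otimes>\<^bsub>A\<^esub> y \<oplus>\<^bsub>A\<^esub> x \<otimes>\<^bsub>A\<^esub> z"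
    and lact_closed: "\<lbrakk>h \<in> carrier H; x \<in> carrier A\<rbrakk> \<Longrightarrow> lact A h x \<in> carrier A"
    and lact_add: "\<lbrakk>h \<in> carrier H; x \<in> carrier A; y \<in> carrier A\<rbrakk>
      \<Longrightarrow> lact A h (x \<oplus>\<^bsub>A\<^esub> y) = lact A h x \<oplus>\<^bsub>A\<^esub> lact A h y"
    and add_lact: "\<lbrakk>h \<in> carrier H; k \<in> carrier H; x \<in> carrier A\<rbrakk>
      \<Longrightarrow> lact A (h \<oplus>\<^bsub>H\<^esub> k) x = lact A h x \<oplus>\<^bsub>A\<^esub> lact A k x"
    and lact_lact: "\<lbrakk>h \<in> carrier H; k \<in> carrier H; x \<in> carrier A\<rbrakk>
      \<Longrightarrow> lact A (h \<otimes>\<^bsub>H\<^esub> k) x = lact A h (lact A k x)"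
    and lact_one: "x \<in> carrier A \<Longrightarrow> lact A \<one>\<^bsub>H\<^esub> x = x"
    and ract_closed: "\<lbrakk>h \<in> carrier H; x \<in> carrier A\<rbrakk> \<Longrightarrow> ract A x h \<in> carrier A"
    and ract_add: "\<lbrakk>h \<in> carrier H; x \<in> carrier A; y \<in> carrier A\<rbrakk>
      \<Longrightarrow> ract A (x \<oplus>\<^bsub>A\<^esub> y) h = ract A x h \<oplus>\<^bsub>A\<^esub> ract A y h"
    and add_ract: "\<lbrakk>h \<in> carrier H; k \<in> carrier H; x \<in> carrier A\<rbrakk>
      \<Longrightarrow> ract A x (h \<oplus>\<^bsub>H\<^esub> k) = ract A x h \<oplus>\<^bsub>A\<^esub> ract A x k"
    and ract_ract: "\<lbrakk>h \<in> carrier H; k \<in> carrier H; x \<in> carrier A\<rbrakk>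
      \<Longrightarrow> ract A x (h \<otimes>\<^bsub>H\<^esub> k) = ract A (ract A x h) k"
    and ract_one: "x \<in> carrier A \<Longrightarrow> ract A x \<one>\<^bsub>H\<^esub> = x"
    and lact_ract: "\<lbrakk>h \<in> carrier H; k \<in> carrier H; x \<in> carrier A\<rbrakk>
      \<Longrightarrow> ract A (lact A h x) k = lact A h (ract A x k)"
    and lact_mult: "\<lbrakk>h \<in> carrier H; x \<in> carrier A; y \<in> carrier A\<rbrakk>
      \<Longrightarrow> lact A h (x \<otimes>\<^bsub>A\<^esub> y) = lact A h x \<otimes>\<^bsub>A\<^esub> y"
    and ract_mult: "\<lbrakk>h \<in> carrier H; x \<in> carrier A; y \<in> carrier A\<rbrakk>
      \<Longrightarrow> ract A (x \<otimes>\<^bsub>A\<^esub> y) h = x \<otimes>\<^bsub>A\<^esub> ract A y h"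
    and balanced: "\<lbrakk>h \<in> carrier H; x \<in> carrier A; y \<in> carrier A\<rbrakk>
      \<Longrightarrow> ract A x h \<otimes>\<^bsub>A\<^esub> y = x \<otimes>\<^bsub>A\<^esub> lact A h y"

text \<open>\<open>A\<close> is the internal direct sum of the subbimodules \<open>G n\<close>, and the product is graded.\<close>

locale nat_graded_halgebra = halgebra H A
  for H :: "('h, 'm) ring_scheme" (structure) and A :: "('h, 'u, 'n) halgebra_scheme" (structure) +
  fixes G :: "nat \<Rightarrow> 'u set"
  assumes degree_subgroup: "subgroup (G n) (add_monoid A)"
    and degree_lact: "\<lbrakk>h \<in> carrier H; x \<in> G n\<rbrakk> \<Longrightarrow> lact A h x \<in> G n"
    and degree_ract: "\<lbrakk>h \<in> carrier H; x \<in> G n\<rbrakk> \<Longrightarrow> ract A x h \<in> G n"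
    and degree_mult: "\<lbrakk>x \<in> G m; y \<in> G n\<rbrakk> \<Longrightarrow> x \<otimes>\<^bsub>A\<^esub> y \<in> G (m + n)"
    and direct_sum: "x \<in> carrier A \<Longrightarrow>
      \<exists>!f. (\<forall>n. f n \<in> G n) \<and> finite {n. f n \<noteq> \<zero>\<^bsub>A\<^esub>} \<and>
        x = (\<Oplus>\<^bsub>A\<^esub>n\<in>{n. f n \<noteq> \<zero>\<^bsub>A\<^esub>}. f n)"


section \<open>A universe of elements\<close>

text \<open>
  The groups \<open>kk(A, B)\<close> involve free algebras, polynomials, matrices and simplicial maps, iterated
  arbitrarily often. So that all these algebras live in one type, their elements are taken from a
  type closed under these constructions, with arbitrary atoms: via \<open>Atom\<close>, every algebra with
  elements in \<open>'a\<close> is isomorphic to one with elements in \<open>('h, 'a) univ\<close>. Quotients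
  are formed by choosing one representative in each class.

  \<open>Std\<close> is a simplex of a standard simplex, given by its sequence of vertices, \<open>Pt\<close> a simplex in
  a collapsed subset, and \<open>Sub n \<sigma> c\<close> the simplex \<open>c\<close> of the subdivision of the
  \<open>n\<close>-simplex \<open>\<sigma>\<close>.
\<close>

datatype simplex = Std (verts: "nat list") | Pt | Sub nat simplex "nat set list"

datatype (scalars: 'h, gens: 'g) tm =
    Gen 'g
  | Zero
  | Plus "('h, 'g) tm" "('h, 'g) tm"
  | Neg "('h, 'g) tm"
  | Times "('h, 'g) tm" "('h, 'g) tm"
  | LAct 'h "('h, 'g) tm"
  | RAct "('h, 'g) tm" 'h

datatype ('h, 'a) univ =
    Atom 'a
  | Term (tm_of: "('h, ('h, 'a) univ) tm")
  | Poly (coeff: "nat \<Rightarrow> ('h, 'a) univ")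
  | MPoly (mcoeff: "nat list \<Rightarrow> ('h, 'a) univ")
  | Mat (entry: "nat \<Rightarrow> nat \<Rightarrow> ('h, 'a) univ")
  | SMap (val: "nat \<Rightarrow> simplex \<Rightarrow> ('h, 'a) univ")

type_synonym ('h, 'a) alg = "('h, ('h, 'a) univ) halgebra"


section \<open>Polynomials and matrices\<close>

definition poly_alg :: "('h, 'a) alg \<Rightarrow> ('h, 'a) alg" where
  "poly_alg X =
    \<lparr>carrier = {Poly p | p. range p \<subseteq> carrier X \<and> finite {n. p n \<noteq> \<zero>\<^bsub>X\<^esub>}},
     mult = (\<lambda>x y. Poly (\<lambda>n. \<Oplus>\<^bsub>X\<^esub>i\<in>{..n}. coeff x i \<otimes>\<^bsub>X\<^esub> coeff y (n - i))),
     one = undefined,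
     zero = Poly (\<lambda>n. \<zero>\<^bsub>X\<^esub>),
     add = (\<lambda>x y. Poly (\<lambda>n. coeff x n \<oplus>\<^bsub>X\<^esub> coeff y n)),
     lact = (\<lambda>h x. Poly (\<lambda>n. lact X h (coeff x n))),
     ract = (\<lambda>x h. Poly (\<lambda>n. ract X (coeff x n) h))\<rparr>"

definition ev0 :: "('h, 'a) univ \<Rightarrow> ('h, 'a) univ" where
  "ev0 p = coeff p 0"

definition ev1 :: "('h, 'a) alg \<Rightarrow> ('h, 'a) univ \<Rightarrow> ('h, 'a) univ" where
  "ev1 X p = (\<Oplus>\<^bsub>X\<^esub>n\<in>{n. coeff p n \<noteq> \<zero>\<^bsub>X\<^esub>}. coeff p n)"

definition path_alg :: "('h, 'a) alg \<Rightarrow> ('h, 'a) alg" where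
  "path_alg X = (poly_alg X)\<lparr>carrier := {p \<in> carrier (poly_alg X). ev0 p = \<zero>\<^bsub>X\<^esub>}\<rparr>"

definition Omega :: "('h, 'a) alg \<Rightarrow> ('h, 'a) alg" where
  "Omega X =
    (poly_alg X)\<lparr>carrier := {p \<in> carrier (poly_alg X). ev0 p = \<zero>\<^bsub>X\<^esub> \<and> ev1 X p = \<zero>\<^bsub>X\<^esub>}\<rparr>"

text \<open>
  Finitely supported matrices with rows and columns indexed by \<open>I\<close>, extended by zero. Thus
  \<open>M\<^sub>k A\<close> is \<open>mat_alg {..<k} A\<close>, \<open>M\<^sub>\<infinity> A\<close> is
  \<open>mat_alg UNIV A\<close>, and upper left corner inclusions are inclusions of sets.
\<close>

definition mat_alg :: "nat set \<Rightarrow> ('h, 'a) alg \<Rightarrow> ('h, 'a) alg" where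
  "mat_alg I X =
    \<lparr>carrier = {Mat m | m. (\<forall>i j. m i j \<in> carrier X) \<and>
       finite {(i, j). m i j \<noteq> \<zero>\<^bsub>X\<^esub>} \<and> {(i, j). m i j \<noteq> \<zero>\<^bsub>X\<^esub>} \<subseteq> I \<times> I},
     mult = (\<lambda>x y. Mat (\<lambda>i j.
       \<Oplus>\<^bsub>X\<^esub>l\<in>{l. entry x i l \<noteq> \<zero>\<^bsub>X\<^esub>}. entry x i l \<otimes>\<^bsub>X\<^esub> entry y l j)),
     one = undefined,
     zero = Mat (\<lambda>i j. \<zero>\<^bsub>X\<^esub>),
     add = (\<lambda>x y. Mat (\<lambda>i j. entry x i j \<oplus>\<^bsub>X\<^esub> entry y i j)),
     lact = (\<lambda>h x. Mat (\<lambda>i j. lact X h (entry x i j))),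
     ract = (\<lambda>x h. Mat (\<lambda>i j. ract X (entry x i j) h))\<rparr>"

definition mat_map :: "(('h, 'a) univ \<Rightarrow> ('h, 'a) univ) \<Rightarrow> ('h, 'a) univ \<Rightarrow> ('h, 'a) univ" where
  "mat_map f x = Mat (\<lambda>i j. f (entry x i j))"

definition corner :: "('h, 'a) alg \<Rightarrow> ('h, 'a) univ \<Rightarrow> ('h, 'a) univ" where
  "corner X x = Mat (\<lambda>i j. if i = 0 \<and> j = 0 then x else \<zero>\<^bsub>X\<^esub>)"

text \<open>\<open>M\<^sub>k \<otimes> M\<^sub>\<infinity>\<close>, the \<open>k\<close>-th ring of \<open>\<M>\<^sub>\<infinity>\<close>.\<close>

definition stab :: "nat \<Rightarrow> ('h, 'a) alg \<Rightarrow> ('h, 'a) alg" where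
  "stab k X = mat_alg {..<k} (mat_alg UNIV X)"

definition stab_map :: "(('h, 'a) univ \<Rightarrow> ('h, 'a) univ) \<Rightarrow> ('h, 'a) univ \<Rightarrow> ('h, 'a) univ" where
  "stab_map f = mat_map (mat_map f)"

definition stab_corner :: "('h, 'a) alg \<Rightarrow> ('h, 'a) univ \<Rightarrow> ('h, 'a) univ" where
  "stab_corner X x = corner (mat_alg UNIV X) (corner X x)"

text \<open>
  The map \<open>\<M>\<^sub>\<infinity> \<otimes> \<M>\<^sub>\<infinity> \<rightarrow> \<M>\<^sub>\<infinity>\<close> given by the tensor product of matrices, where
  pairs of indices are numbered by \<^const>\<open>prod_encode\<close>. Since it maps \<open>{..<l} \<times> {..<k}\<close> into
  \<open>{..<prod_encode (l, k)}\<close>, this sends \<open>stab l (stab k X)\<close> to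
  \<open>stab (prod_encode (l, k)) X\<close>.
\<close>

definition mat_combine :: "('h, 'a) univ \<Rightarrow> ('h, 'a) univ" where
  "mat_combine x = Mat (\<lambda>i j. Mat (\<lambda>a b.
     entry (entry (entry (entry x
       (fst (prod_decode i)) (fst (prod_decode j)))
       (fst (prod_decode a)) (fst (prod_decode b)))
       (snd (prod_decode i)) (snd (prod_decode j)))
       (snd (prod_decode a)) (snd (prod_decode b))))"

text \<open>Block sum \<open>M\<^sub>k \<times> M\<^sub>l \<rightarrow> M\<^sub>k\<^sub>+\<^sub>l\<close>.\<close>

definition block_sum ::
  "('h, 'a) alg \<Rightarrow> nat \<Rightarrow> ('h, 'a) univ \<Rightarrow> ('h, 'a) univ \<Rightarrow> ('h, 'a) univ" where
  "block_sum X k x y = Mat (\<lambda>i j.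
     if i < k \<and> j < k then entry x i j
     else if k \<le> i \<and> k \<le> j then entry y (i - k) (j - k)
     else \<zero>\<^bsub>X\<^esub>)"


section \<open>Simplicial sets and subdivision\<close>

text \<open>
  A monotone map \<open>[m] \<rightarrow> [n]\<close> is the list of its \<open>m + 1\<close> values; \<open>restr K n \<theta> \<sigma>\<close>
  is \<open>\<theta>\<^sup>*\<sigma>\<close> for \<open>\<sigma> \<in> K\<^sub>n\<close>.
\<close>

record sset =
  simps :: "nat \<Rightarrow> simplex set"
  restr :: "nat \<Rightarrow> nat list \<Rightarrow> simplex \<Rightarrow> simplex"

definition mono_maps :: "nat \<Rightarrow> nat \<Rightarrow> nat list set" where
  "mono_maps m n = {\<theta>. length \<theta> = m + 1 \<and> sorted \<theta> \<and> set \<theta> \<subseteq> {..n}}"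

definition Delta :: "nat \<Rightarrow> sset" where
  "Delta k = \<lparr>simps = (\<lambda>n. Std ` mono_maps n k),
              restr = (\<lambda>n \<theta> \<sigma>. Std (map (\<lambda>i. verts \<sigma> ! i) \<theta>))\<rparr>"

definition boundary :: "nat \<Rightarrow> nat \<Rightarrow> simplex set" where
  "boundary k n = Std ` {\<theta> \<in> mono_maps n k. set \<theta> \<noteq> {..k}}"

definition collapse :: "sset \<Rightarrow> (nat \<Rightarrow> simplex set) \<Rightarrow> sset" where
  "collapse K L =
    \<lparr>simps = (\<lambda>n. insert Pt (simps K n - L n)),
     restr = (\<lambda>n \<theta> \<sigma>. if \<sigma> = Pt \<or> restr K n \<theta> \<sigma> \<in> L (length \<theta> - 1) then Pt
                        else restr K n \<theta> \<sigma>)\<rparr>"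

definition circle :: sset where
  "circle = collapse (Delta 1) (boundary 1)"

text \<open>
  The subdivision of \<open>K\<close> is the colimit, over the simplices of \<open>K\<close>, of the nerves of the
  posets of nonempty subsets of \<open>[n]\<close>.
\<close>

definition sd_pairs :: "sset \<Rightarrow> nat \<Rightarrow> simplex set" where
  "sd_pairs K m = {Sub n \<sigma> c | n \<sigma> c. \<sigma> \<in> simps K n \<and> length c = m + 1 \<and>
     sorted_wrt (\<subseteq>) c \<and> (\<forall>S\<in>set c. S \<noteq> {} \<and> S \<subseteq> {..n})}"

inductive sd_step :: "sset \<Rightarrow> simplex \<Rightarrow> simplex \<Rightarrow> bool" for K where
  "\<lbrakk>\<theta> \<in> mono_maps n' n; \<sigma> \<in> simps K n; Sub n' (restr K n \<theta> \<sigma>) c \<in> sd_pairs K m\<rbrakk>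
    \<Longrightarrow> sd_step K (Sub n' (restr K n \<theta> \<sigma>) c) (Sub n \<sigma> (map (\<lambda>S. (\<lambda>i. \<theta> ! i) ` S) c))"

definition sd_rep :: "sset \<Rightarrow> simplex \<Rightarrow> simplex" where
  "sd_rep K s = (SOME s'. equivclp (sd_step K) s s')"

definition sd :: "sset \<Rightarrow> sset" where
  "sd K = \<lparr>simps = (\<lambda>m. sd_rep K ` sd_pairs K m),
           restr = (\<lambda>m \<theta> s. case s of Sub n \<sigma> c \<Rightarrow> sd_rep K (Sub n \<sigma> (map (\<lambda>i. c ! i) \<theta>)))\<rparr>"

definition last_vertex :: "sset \<Rightarrow> simplex \<Rightarrow> simplex" where
  "last_vertex K s = (case s of Sub n \<sigma> c \<Rightarrow> restr K n (map Max c) \<sigma>)"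

primrec sd_circle :: "nat \<Rightarrow> sset \<times> simplex" where
  "sd_circle 0 = (circle, Pt)"
| "sd_circle (Suc p) =
    (sd (fst (sd_circle p)), sd_rep (fst (sd_circle p)) (Sub 0 (snd (sd_circle p)) [{0}]))"


section \<open>The simplicial algebra and function algebras\<close>

text \<open>Polynomials in \<open>t\<^sub>0, \<dots>, t\<^sub>n\<close>, with exponents given as lists of length \<open>n + 1\<close>.\<close>

definition mpoly_alg :: "('h, 'a) alg \<Rightarrow> nat \<Rightarrow> ('h, 'a) alg" where
  "mpoly_alg X n =
    \<lparr>carrier = {MPoly p | p. range p \<subseteq> carrier X \<and> finite {d. p d \<noteq> \<zero>\<^bsub>X\<^esub>} \<and>
       (\<forall>d. length d \<noteq> n + 1 \<longrightarrow> p d = \<zero>\<^bsub>X\<^esub>)},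
     mult = (\<lambda>x y. MPoly (\<lambda>d.
       \<Oplus>\<^bsub>X\<^esub>e\<in>{e. list_all2 (\<le>) e d}. mcoeff x e \<otimes>\<^bsub>X\<^esub> mcoeff y (map2 (-) d e))),
     one = undefined,
     zero = MPoly (\<lambda>d. \<zero>\<^bsub>X\<^esub>),
     add = (\<lambda>x y. MPoly (\<lambda>d. mcoeff x d \<oplus>\<^bsub>X\<^esub> mcoeff y d)),
     lact = (\<lambda>h x. MPoly (\<lambda>d. lact X h (mcoeff x d))),
     ract = (\<lambda>x h. MPoly (\<lambda>d. ract X (mcoeff x d) h))\<rparr>"

text \<open>Congruence modulo multiples of \<open>1 - \<Sum>t\<^sub>i\<close>.\<close>

definition simplex_cong ::
  "('h, 'a) alg \<Rightarrow> nat \<Rightarrow> ('h, 'a) univ \<Rightarrow> ('h, 'a) univ \<Rightarrow> bool" where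
  "simplex_cong X n x y \<longleftrightarrow> y \<in> carrier (mpoly_alg X n) \<and>
    (\<exists>r\<in>carrier (mpoly_alg X n). \<forall>d. length d = n + 1 \<longrightarrow>
      mcoeff x d \<ominus>\<^bsub>X\<^esub> mcoeff y d =
      mcoeff r d \<ominus>\<^bsub>X\<^esub> (\<Oplus>\<^bsub>X\<^esub>i\<in>{i. i \<le> n \<and> 0 < d ! i}. mcoeff r (d[i := d ! i - 1])))"

definition simplex_rep :: "('h, 'a) alg \<Rightarrow> nat \<Rightarrow> ('h, 'a) univ \<Rightarrow> ('h, 'a) univ" where
  "simplex_rep X n x = (SOME y. simplex_cong X n x y)"

definition simplex_alg :: "('h, 'a) alg \<Rightarrow> nat \<Rightarrow> ('h, 'a) alg" where
  "simplex_alg X n =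
    \<lparr>carrier = simplex_rep X n ` carrier (mpoly_alg X n),
     mult = (\<lambda>x y. simplex_rep X n (x \<otimes>\<^bsub>mpoly_alg X n\<^esub> y)),
     one = undefined,
     zero = simplex_rep X n \<zero>\<^bsub>mpoly_alg X n\<^esub>,
     add = (\<lambda>x y. simplex_rep X n (x \<oplus>\<^bsub>mpoly_alg X n\<^esub> y)),
     lact = (\<lambda>h x. simplex_rep X n (lact (mpoly_alg X n) h x)),
     ract = (\<lambda>x h. simplex_rep X n (ract (mpoly_alg X n) x h))\<rparr>"

text \<open>
  The substitution \<open>t\<^sub>i \<mapsto> \<Sum>\<^sub>\<theta>\<^sub>(\<^sub>j\<^sub>)\<^sub>=\<^sub>i t\<^sub>j\<close> for \<open>\<theta> : [m] \<rightarrow> [n]\<close>. By the multinomial theorem,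
  the monomial with exponent \<open>d\<close> only occurs in the image of the monomial with exponent
  \<open>e\<close>, where \<open>e\<^sub>i\<close> is the sum of the \<open>d\<^sub>j\<close> with \<open>\<theta>(j) = i\<close>, and has coefficient
  \<open>\<Prod>\<^sub>i e\<^sub>i! / \<Prod>\<^sub>j d\<^sub>j!\<close> there.
\<close>

definition pull_exponent :: "nat \<Rightarrow> nat list \<Rightarrow> nat list \<Rightarrow> nat list" where
  "pull_exponent n \<theta> d = map (\<lambda>i. \<Sum>j | j < length \<theta> \<and> \<theta> ! j = i. d ! j) [0..<n + 1]"

definition mpoly_subst ::
  "('h, 'a) alg \<Rightarrow> nat \<Rightarrow> nat list \<Rightarrow> ('h, 'a) univ \<Rightarrow> ('h, 'a) univ" where
  "mpoly_subst X n \<theta> x = MPoly (\<lambda>d.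
     if length d = length \<theta>
     then [(prod_list (map fact (pull_exponent n \<theta> d)) div prod_list (map fact d) :: nat)]
            \<cdot>\<^bsub>X\<^esub> mcoeff x (pull_exponent n \<theta> d)
     else \<zero>\<^bsub>X\<^esub>)"

definition simplex_restr ::
  "('h, 'a) alg \<Rightarrow> nat \<Rightarrow> nat list \<Rightarrow> ('h, 'a) univ \<Rightarrow> ('h, 'a) univ" where
  "simplex_restr X n \<theta> x = simplex_rep X (length \<theta> - 1) (mpoly_subst X n \<theta> x)"

text \<open>\<open>X\<^sup>K\<close>; elements take the value \<^const>\<open>undefined\<close> outside the simplices of \<open>K\<close>.\<close>

definition fun_alg :: "('h, 'a) alg \<Rightarrow> sset \<Rightarrow> ('h, 'a) alg" where
  "fun_alg X K =
    \<lparr>carrier = {SMap f | f.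
       (\<forall>n. \<forall>\<sigma>\<in>simps K n. f n \<sigma> \<in> carrier (simplex_alg X n)) \<and>
       (\<forall>n. \<forall>\<sigma>. \<sigma> \<notin> simps K n \<longrightarrow> f n \<sigma> = undefined) \<and>
       (\<forall>m n. \<forall>\<theta>\<in>mono_maps m n. \<forall>\<sigma>\<in>simps K n.
          f m (restr K n \<theta> \<sigma>) = simplex_restr X n \<theta> (f n \<sigma>))},
     mult = (\<lambda>x y. SMap (\<lambda>n \<sigma>.
       if \<sigma> \<in> simps K n then val x n \<sigma> \<otimes>\<^bsub>simplex_alg X n\<^esub> val y n \<sigma> else undefined)),
     one = undefined,
     zero = SMap (\<lambda>n \<sigma>. if \<sigma> \<in> simps K n then \<zero>\<^bsub>simplex_alg X n\<^esub> else undefined),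
     add = (\<lambda>x y. SMap (\<lambda>n \<sigma>.
       if \<sigma> \<in> simps K n then val x n \<sigma> \<oplus>\<^bsub>simplex_alg X n\<^esub> val y n \<sigma> else undefined)),
     lact = (\<lambda>h x. SMap (\<lambda>n \<sigma>.
       if \<sigma> \<in> simps K n then lact (simplex_alg X n) h (val x n \<sigma>) else undefined)),
     ract = (\<lambda>x h. SMap (\<lambda>n \<sigma>.
       if \<sigma> \<in> simps K n then ract (simplex_alg X n) (val x n \<sigma>) h else undefined))\<rparr>"

definition pfun_alg :: "('h, 'a) alg \<Rightarrow> sset \<Rightarrow> simplex \<Rightarrow> ('h, 'a) alg" where
  "pfun_alg X K b =
    (fun_alg X K)\<lparr>carrier := {x \<in> carrier (fun_alg X K). val x 0 b = \<zero>\<^bsub>simplex_alg X 0\<^esub>}\<rparr>"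

text \<open>
  The map \<open>X\<^sup>K \<rightarrow> Y\<^sup>K\<close> induced by an additive map \<open>X \<rightarrow> Y\<close>, multiplicative or not.
\<close>

definition fun_map ::
  "sset \<Rightarrow> ('h, 'a) alg \<Rightarrow> (('h, 'a) univ \<Rightarrow> ('h, 'a) univ) \<Rightarrow> ('h, 'a) univ \<Rightarrow> ('h, 'a) univ" where
  "fun_map K Y f x = SMap (\<lambda>n \<sigma>.
     if \<sigma> \<in> simps K n then simplex_rep Y n (MPoly (\<lambda>d. f (mcoeff (val x n \<sigma>) d))) else undefined)"

text \<open>
  \<open>spheres [p\<^sub>1, \<dots>, p\<^sub>n] X\<close> is the algebra with index \<open>(p\<^sub>1, \<dots>, p\<^sub>n)\<close> in the ind-algebra
  \<open>X\<^bsup>\<S>\<^sup>n\<^esup>\<close>; the head of the list belongs to the outermost loop algebra.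
\<close>

definition loop :: "nat \<Rightarrow> ('h, 'a) alg \<Rightarrow> ('h, 'a) alg" where
  "loop p X = pfun_alg X (fst (sd_circle p)) (snd (sd_circle p))"

definition loop_map ::
  "nat \<Rightarrow> ('h, 'a) alg \<Rightarrow> (('h, 'a) univ \<Rightarrow> ('h, 'a) univ) \<Rightarrow> ('h, 'a) univ \<Rightarrow> ('h, 'a) univ" where
  "loop_map p = fun_map (fst (sd_circle p))"

primrec loop_refine :: "nat \<Rightarrow> nat \<Rightarrow> ('h, 'a) univ \<Rightarrow> ('h, 'a) univ" where
  "loop_refine p 0 x = x"
| "loop_refine p (Suc k) x = SMap (\<lambda>n \<sigma>.
     if \<sigma> \<in> simps (fst (sd_circle (Suc (p + k)))) n
     then val (loop_refine p k x) n (last_vertex (fst (sd_circle (p + k))) \<sigma>)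
     else undefined)"

primrec spheres :: "nat list \<Rightarrow> ('h, 'a) alg \<Rightarrow> ('h, 'a) alg" where
  "spheres [] X = X"
| "spheres (p # ps) X = loop p (spheres ps X)"

primrec spheres_map ::
  "nat list \<Rightarrow> ('h, 'a) alg \<Rightarrow> (('h, 'a) univ \<Rightarrow> ('h, 'a) univ) \<Rightarrow> ('h, 'a) univ \<Rightarrow> ('h, 'a) univ" where
  "spheres_map [] Y f = f"
| "spheres_map (p # ps) Y f = loop_map p (spheres ps Y) (spheres_map ps Y f)"

fun spheres_bond ::
  "('h, 'a) alg \<Rightarrow> nat list \<Rightarrow> nat list \<Rightarrow> ('h, 'a) univ \<Rightarrow> ('h, 'a) univ" where
  "spheres_bond X (p # ps) (q # qs) x =
     loop_refine p (q - p) (loop_map p (spheres qs X) (spheres_bond X ps qs) x)"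
| "spheres_bond X _ _ x = x"

text \<open>
  The identification of \<open>\<Omega>X\<close> with \<open>X\<^sup>(\<^sup>S\<^sup>1\<^sup>,\<^sup>\<star>\<^sup>)\<close>: a polynomial \<open>p(t)\<close>
  is regarded as the element \<open>p(t\<^sub>1)\<close> of \<open>X\<^sup>\<Delta>\<close> in dimension 1.
\<close>

definition Omega_to_loop :: "('h, 'a) alg \<Rightarrow> ('h, 'a) univ \<Rightarrow> ('h, 'a) univ" where
  "Omega_to_loop X x = SMap (\<lambda>n \<sigma>.
     if \<sigma> \<in> simps circle n then
       (case \<sigma> of
          Std \<theta> \<Rightarrow> simplex_restr X 1 \<theta>
            (simplex_rep X 1 (MPoly (\<lambda>d. if length d = 2 \<and> d ! 0 = 0 then coeff x (d ! 1) else \<zero>\<^bsub>X\<^esub>)))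
        | _ \<Rightarrow> \<zero>\<^bsub>simplex_alg X n\<^esub>)
     else undefined)"

text \<open>The identification of \<open>(\<M>\<^sub>\<infinity> X)\<^bsup>\<S>\<^sup>n\<^esup>\<close> with \<open>\<M>\<^sub>\<infinity> X\<^bsup>\<S>\<^sup>n\<^esup>\<close>.\<close>

definition swap_stab :: "nat list \<Rightarrow> ('h, 'a) alg \<Rightarrow> ('h, 'a) univ \<Rightarrow> ('h, 'a) univ" where
  "swap_stab ps X x =
     Mat (\<lambda>i j. Mat (\<lambda>a b. spheres_map ps X (\<lambda>y. entry (entry y i j) a b) x))"


section \<open>Ind-algebras\<close>

text \<open>
  All index sets consist of lists of numbers of a fixed length, with the componentwise order.
\<close>

record ('h, 'a) ind_alg =
  inds :: "nat list set"
  obj :: "nat list \<Rightarrow> ('h, 'a) alg"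
  bond :: "nat list \<Rightarrow> nat list \<Rightarrow> ('h, 'a) univ \<Rightarrow> ('h, 'a) univ"

definition ind_spheres :: "nat \<Rightarrow> ('h, 'a) alg \<Rightarrow> ('h, 'a) ind_alg" where
  "ind_spheres n X =
    \<lparr>inds = {ps. length ps = n}, obj = (\<lambda>ps. spheres ps X), bond = spheres_bond X\<rparr>"

definition ind_stab :: "('h, 'a) ind_alg \<Rightarrow> ('h, 'a) ind_alg" where
  "ind_stab I =
    \<lparr>inds = {k # ps | k ps. ps \<in> inds I},
     obj = (\<lambda>j. stab (hd j) (obj I (tl j))),
     bond = (\<lambda>j j'. stab_map (bond I (tl j) (tl j')))\<rparr>"


section \<open>The category \<open>kk\<close>\<close>

datatype underlying = Sets | AbGroups | Bimodules

type_synonym ('h, 'a) kk_element = "(nat \<times> (nat list \<times> (('h, 'a) univ \<Rightarrow> ('h, 'a) univ)) set) set"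

text \<open>
  \<open>central\<close> selects between all algebras and the central ones, and \<open>U\<close> is the underlying
  category.
\<close>

locale kk_theory = ring H for H :: "('h, 'm) ring_scheme" (structure) +
  fixes central :: bool and U :: underlying
  assumes central_comm: "central \<Longrightarrow> cring H"
begin

definition is_alg :: "('h, 'u, 'n) halgebra_scheme \<Rightarrow> bool" where
  "is_alg A \<longleftrightarrow> halgebra H A \<and>
    (central \<longrightarrow> (\<forall>h\<in>carrier H. \<forall>x\<in>carrier A. lact A h x = ract A x h))"

definition alg_hom :: "('h, 'a) alg \<Rightarrow> ('h, 'a) alg \<Rightarrow> (('h, 'a) univ \<Rightarrow> ('h, 'a) univ) \<Rightarrow> bool" where
  "alg_hom X Y f \<longleftrightarrow> f \<in> carrier X \<rightarrow> carrier Y \<and>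
    (\<forall>x\<in>carrier X. \<forall>y\<in>carrier X. f (x \<oplus>\<^bsub>X\<^esub> y) = f x \<oplus>\<^bsub>Y\<^esub> f y \<and> f (x \<otimes>\<^bsub>X\<^esub> y) = f x \<otimes>\<^bsub>Y\<^esub> f y) \<and>
    (\<forall>h\<in>carrier H. \<forall>x\<in>carrier X. f (lact X h x) = lact Y h (f x) \<and> f (ract X x h) = ract Y (f x) h)"

definition U_morphism :: "('h, 'a) alg \<Rightarrow> ('h, 'a) alg \<Rightarrow> (('h, 'a) univ \<Rightarrow> ('h, 'a) univ) \<Rightarrow> bool" where
  "U_morphism X Y f \<longleftrightarrow> f \<in> carrier X \<rightarrow> carrier Y \<and>
    (U \<noteq> Sets \<longrightarrow> (\<forall>x\<in>carrier X. \<forall>y\<in>carrier X. f (x \<oplus>\<^bsub>X\<^esub> y) = f x \<oplus>\<^bsub>Y\<^esub> f y)) \<and>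
    (U = Bimodules \<longrightarrow>
      (\<forall>h\<in>carrier H. \<forall>x\<in>carrier X. f (lact X h x) = lact Y h (f x) \<and> f (ract X x h) = ract Y (f x) h))"

subsection \<open>The free algebra on an underlying object\<close>

definition tms :: "('h, 'a) alg \<Rightarrow> ('h, ('h, 'a) univ) tm set" where
  "tms X = {t. gens t \<subseteq> carrier X \<and> scalars t \<subseteq> carrier H}"

text \<open>
  The congruence presenting the value at \<open>X\<close> of the left adjoint of the forgetful functor: it is
  generated by the axioms of \<open>H\<close>-algebras and by the relations making \<open>Gen\<close> a morphism in
  the underlying category.
\<close>

inductive tm_eq :: "('h, 'a) alg \<Rightarrow> ('h, ('h, 'a) univ) tm \<Rightarrow> ('h, ('h, 'a) univ) tm \<Rightarrow> bool" for X where
  refl: "t \<in> tms X \<Longrightarrow> tm_eq X t t"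
| sym: "tm_eq X s t \<Longrightarrow> tm_eq X t s"
| trans: "\<lbrakk>tm_eq X s t; tm_eq X t u\<rbrakk> \<Longrightarrow> tm_eq X s u"
| cong_plus: "\<lbrakk>tm_eq X s s'; tm_eq X t t'\<rbrakk> \<Longrightarrow> tm_eq X (Plus s t) (Plus s' t')"
| cong_neg: "tm_eq X s s' \<Longrightarrow> tm_eq X (Neg s) (Neg s')"
| cong_times: "\<lbrakk>tm_eq X s s'; tm_eq X t t'\<rbrakk> \<Longrightarrow> tm_eq X (Times s t) (Times s' t')"
| cong_lact: "\<lbrakk>h \<in> carrier H; tm_eq X s s'\<rbrakk> \<Longrightarrow> tm_eq X (LAct h s) (LAct h s')"
| cong_ract: "\<lbrakk>h \<in> carrier H; tm_eq X s s'\<rbrakk> \<Longrightarrow> tm_eq X (RAct s h) (RAct s' h)"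
| plus_assoc: "\<lbrakk>s \<in> tms X; t \<in> tms X; u \<in> tms X\<rbrakk> \<Longrightarrow> tm_eq X (Plus (Plus s t) u) (Plus s (Plus t u))"
| plus_comm: "\<lbrakk>s \<in> tms X; t \<in> tms X\<rbrakk> \<Longrightarrow> tm_eq X (Plus s t) (Plus t s)"
| plus_zero: "s \<in> tms X \<Longrightarrow> tm_eq X (Plus Zero s) s"
| plus_neg: "s \<in> tms X \<Longrightarrow> tm_eq X (Plus (Neg s) s) Zero"
| times_assoc: "\<lbrakk>s \<in> tms X; t \<in> tms X; u \<in> tms X\<rbrakk> \<Longrightarrow> tm_eq X (Times (Times s t) u) (Times s (Times t u))"
| times_l_distr: "\<lbrakk>s \<in> tms X; t \<in> tms X; u \<in> tms X\<rbrakk> \<Longrightarrow> tm_eq X (Times (Plus s t) u) (Plus (Times s u) (Times t u))"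
| times_r_distr: "\<lbrakk>s \<in> tms X; t \<in> tms X; u \<in> tms X\<rbrakk> \<Longrightarrow> tm_eq X (Times s (Plus t u)) (Plus (Times s t) (Times s u))"
| lact_plus: "\<lbrakk>h \<in> carrier H; s \<in> tms X; t \<in> tms X\<rbrakk> \<Longrightarrow> tm_eq X (LAct h (Plus s t)) (Plus (LAct h s) (LAct h t))"
| plus_lact: "\<lbrakk>h \<in> carrier H; k \<in> carrier H; s \<in> tms X\<rbrakk> \<Longrightarrow> tm_eq X (LAct (h \<oplus> k) s) (Plus (LAct h s) (LAct k s))"
| lact_lact: "\<lbrakk>h \<in> carrier H; k \<in> carrier H; s \<in> tms X\<rbrakk> \<Longrightarrow> tm_eq X (LAct (h \<otimes> k) s) (LAct h (LAct k s))"
| lact_one: "s \<in> tms X \<Longrightarrow> tm_eq X (LAct \<one> s) s"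
| ract_plus: "\<lbrakk>h \<in> carrier H; s \<in> tms X; t \<in> tms X\<rbrakk> \<Longrightarrow> tm_eq X (RAct (Plus s t) h) (Plus (RAct s h) (RAct t h))"
| plus_ract: "\<lbrakk>h \<in> carrier H; k \<in> carrier H; s \<in> tms X\<rbrakk> \<Longrightarrow> tm_eq X (RAct s (h \<oplus> k)) (Plus (RAct s h) (RAct s k))"
| ract_ract: "\<lbrakk>h \<in> carrier H; k \<in> carrier H; s \<in> tms X\<rbrakk> \<Longrightarrow> tm_eq X (RAct s (h \<otimes> k)) (RAct (RAct s h) k)"
| ract_one: "s \<in> tms X \<Longrightarrow> tm_eq X (RAct s \<one>) s"
| lact_ract: "\<lbrakk>h \<in> carrier H; k \<in> carrier H; s \<in> tms X\<rbrakk> \<Longrightarrow> tm_eq X (RAct (LAct h s) k) (LAct h (RAct s k))"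
| lact_times: "\<lbrakk>h \<in> carrier H; s \<in> tms X; t \<in> tms X\<rbrakk> \<Longrightarrow> tm_eq X (LAct h (Times s t)) (Times (LAct h s) t)"
| ract_times: "\<lbrakk>h \<in> carrier H; s \<in> tms X; t \<in> tms X\<rbrakk> \<Longrightarrow> tm_eq X (RAct (Times s t) h) (Times s (RAct t h))"
| times_balanced: "\<lbrakk>h \<in> carrier H; s \<in> tms X; t \<in> tms X\<rbrakk> \<Longrightarrow> tm_eq X (Times (RAct s h) t) (Times s (LAct h t))"
| lact_central: "\<lbrakk>central; h \<in> carrier H; s \<in> tms X\<rbrakk> \<Longrightarrow> tm_eq X (LAct h s) (RAct s h)"
| gen_plus: "\<lbrakk>U \<noteq> Sets; x \<in> carrier X; y \<in> carrier X\<rbrakk> \<Longrightarrow> tm_eq X (Gen (x \<oplus>\<^bsub>X\<^esub> y)) (Plus (Gen x) (Gen y))"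
| gen_lact: "\<lbrakk>U = Bimodules; h \<in> carrier H; x \<in> carrier X\<rbrakk> \<Longrightarrow> tm_eq X (Gen (lact X h x)) (LAct h (Gen x))"
| gen_ract: "\<lbrakk>U = Bimodules; h \<in> carrier H; x \<in> carrier X\<rbrakk> \<Longrightarrow> tm_eq X (Gen (ract X x h)) (RAct (Gen x) h)"

definition tm_rep :: "('h, 'a) alg \<Rightarrow> ('h, ('h, 'a) univ) tm \<Rightarrow> ('h, 'a) univ" where
  "tm_rep X t = Term (SOME t'. tm_eq X t t')"

definition T :: "('h, 'a) alg \<Rightarrow> ('h, 'a) alg" where
  "T X =
    \<lparr>carrier = tm_rep X ` tms X,
     mult = (\<lambda>x y. tm_rep X (Times (tm_of x) (tm_of y))),
     one = undefined,
     zero = tm_rep X Zero,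
     add = (\<lambda>x y. tm_rep X (Plus (tm_of x) (tm_of y))),
     lact = (\<lambda>h x. tm_rep X (LAct h (tm_of x))),
     ract = (\<lambda>x h. tm_rep X (RAct (tm_of x) h))\<rparr>"

definition T_map ::
  "('h, 'a) alg \<Rightarrow> (('h, 'a) univ \<Rightarrow> ('h, 'a) univ) \<Rightarrow> ('h, 'a) univ \<Rightarrow> ('h, 'a) univ" where
  "T_map Y f x = tm_rep Y (map_tm (\<lambda>h. h) f (tm_of x))"

primrec eval_tm ::
  "('h, 'a) alg \<Rightarrow> (('h, 'a) univ \<Rightarrow> ('h, 'a) univ) \<Rightarrow> ('h, ('h, 'a) univ) tm \<Rightarrow> ('h, 'a) univ" where
  "eval_tm Y s (Gen x) = s x"
| "eval_tm Y s Zero = \<zero>\<^bsub>Y\<^esub>"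
| "eval_tm Y s (Plus t u) = eval_tm Y s t \<oplus>\<^bsub>Y\<^esub> eval_tm Y s u"
| "eval_tm Y s (Neg t) = \<ominus>\<^bsub>Y\<^esub> eval_tm Y s t"
| "eval_tm Y s (Times t u) = eval_tm Y s t \<otimes>\<^bsub>Y\<^esub> eval_tm Y s u"
| "eval_tm Y s (LAct h t) = lact Y h (eval_tm Y s t)"
| "eval_tm Y s (RAct t h) = ract Y (eval_tm Y s t) h"

definition counit :: "('h, 'a) alg \<Rightarrow> ('h, 'a) univ \<Rightarrow> ('h, 'a) univ" where
  "counit X x = eval_tm X (\<lambda>y. y) (tm_of x)"

definition J :: "('h, 'a) alg \<Rightarrow> ('h, 'a) alg" where
  "J X = (T X)\<lparr>carrier := {x \<in> carrier (T X). counit X x = \<zero>\<^bsub>X\<^esub>}\<rparr>"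

primrec J_iter_map ::
  "nat \<Rightarrow> ('h, 'a) alg \<Rightarrow> (('h, 'a) univ \<Rightarrow> ('h, 'a) univ) \<Rightarrow> ('h, 'a) univ \<Rightarrow> ('h, 'a) univ" where
  "J_iter_map 0 Y f = f"
| "J_iter_map (Suc n) Y f = T_map ((J ^^ n) Y) (J_iter_map n Y f)"

subsection \<open>Classifying maps\<close>

text \<open>
  The classifying map \<open>J(C) \<rightarrow> A\<close> of an extension \<open>A \<rightarrow> B \<rightarrow> C\<close> with inclusion \<open>i\<close>,
  with respect to a section \<open>s\<close> of the underlying map of \<open>B \<rightarrow> C\<close>.
\<close>

definition classifying ::
  "('h, 'a) alg \<Rightarrow> (('h, 'a) univ \<Rightarrow> ('h, 'a) univ) \<Rightarrow> ('h, 'a) alg \<Rightarrow> (('h, 'a) univ \<Rightarrow> ('h, 'a) univ)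
    \<Rightarrow> ('h, 'a) univ \<Rightarrow> ('h, 'a) univ" where
  "classifying A i B s x = inv_into (carrier A) i (eval_tm B s (tm_of x))"

definition some_section ::
  "('h, 'a) alg \<Rightarrow> (('h, 'a) univ \<Rightarrow> ('h, 'a) univ) \<Rightarrow> ('h, 'a) alg \<Rightarrow> ('h, 'a) univ \<Rightarrow> ('h, 'a) univ" where
  "some_section B g C = (SOME s. U_morphism C B s \<and> (\<forall>c\<in>carrier C. g (s c) = c))"

definition rho :: "('h, 'a) alg \<Rightarrow> ('h, 'a) univ \<Rightarrow> ('h, 'a) univ" where
  "rho X x = Omega_to_loop X
     (classifying (Omega X) (\<lambda>y. y) (path_alg X) (\<lambda>a. Poly (\<lambda>n. if n = 1 then a else \<zero>\<^bsub>X\<^esub>)) x)"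

text \<open>
  The map \<open>J(LX) \<rightarrow> LJ(X)\<close> for a functor \<open>L\<close> of the form \<open>L \<otimes> _\<close>. It is given by its
  values \<open>Lo\<close> on objects and \<open>Lm\<close> on morphisms; the first argument of \<open>Lm\<close> is the target
  of the morphism.
\<close>

definition gamma ::
  "(('h, 'a) alg \<Rightarrow> ('h, 'a) alg)
    \<Rightarrow> (('h, 'a) alg \<Rightarrow> (('h, 'a) univ \<Rightarrow> ('h, 'a) univ) \<Rightarrow> ('h, 'a) univ \<Rightarrow> ('h, 'a) univ)
    \<Rightarrow> ('h, 'a) alg \<Rightarrow> ('h, 'a) univ \<Rightarrow> ('h, 'a) univ" where
  "gamma Lo Lm X = classifying (Lo (J X)) (Lm (T X) (\<lambda>x. x)) (Lo (T X))
     (some_section (Lo (T X)) (Lm X (counit X)) (Lo X))"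

primrec gamma_iter ::
  "nat \<Rightarrow> (('h, 'a) alg \<Rightarrow> ('h, 'a) alg)
    \<Rightarrow> (('h, 'a) alg \<Rightarrow> (('h, 'a) univ \<Rightarrow> ('h, 'a) univ) \<Rightarrow> ('h, 'a) univ \<Rightarrow> ('h, 'a) univ)
    \<Rightarrow> ('h, 'a) alg \<Rightarrow> ('h, 'a) univ \<Rightarrow> ('h, 'a) univ" where
  "gamma_iter 0 Lo Lm X = (\<lambda>x. x)"
| "gamma_iter (Suc n) Lo Lm X =
     gamma Lo Lm ((J ^^ n) X) \<circ> T_map (Lo ((J ^^ n) X)) (gamma_iter n Lo Lm X)"

subsection \<open>Homotopy classes\<close>

definition elem_homotopic ::
  "('h, 'a) alg \<Rightarrow> ('h, 'a) alg \<Rightarrow> (('h, 'a) univ \<Rightarrow> ('h, 'a) univ) \<Rightarrow> (('h, 'a) univ \<Rightarrow> ('h, 'a) univ) \<Rightarrow> bool" where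
  "elem_homotopic X Y f g \<longleftrightarrow> alg_hom X Y f \<and> alg_hom X Y g \<and>
    (\<exists>h. alg_hom X (poly_alg Y) h \<and> (\<forall>x\<in>carrier X. ev0 (h x) = f x \<and> ev1 Y (h x) = g x))"

definition homotopic ::
  "('h, 'a) alg \<Rightarrow> ('h, 'a) alg \<Rightarrow> (('h, 'a) univ \<Rightarrow> ('h, 'a) univ) \<Rightarrow> (('h, 'a) univ \<Rightarrow> ('h, 'a) univ) \<Rightarrow> bool" where
  "homotopic X Y = equivclp (elem_homotopic X Y)"

text \<open>
  \<open>ind_classes X I\<close> is \<open>[X, I]\<close>, the colimit of the sets \<open>[X, I\<^sub>j]\<close>, for an
  algebra \<open>X\<close> and an ind-algebra \<open>I\<close>. Its elements are represented by an index \<open>j\<close> and a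
  homomorphism \<open>X \<rightarrow> I\<^sub>j\<close>.
\<close>

definition ind_homs ::
  "('h, 'a) alg \<Rightarrow> ('h, 'a) ind_alg \<Rightarrow> (nat list \<times> (('h, 'a) univ \<Rightarrow> ('h, 'a) univ)) set" where
  "ind_homs X I = {(j, f). j \<in> inds I \<and> alg_hom X (obj I j) f}"

definition ind_class ::
  "('h, 'a) alg \<Rightarrow> ('h, 'a) ind_alg \<Rightarrow> nat list \<Rightarrow> (('h, 'a) univ \<Rightarrow> ('h, 'a) univ)
    \<Rightarrow> (nat list \<times> (('h, 'a) univ \<Rightarrow> ('h, 'a) univ)) set" where
  "ind_class X I j f = {(j', f') \<in> ind_homs X I.
     \<exists>l\<in>inds I. list_all2 (\<le>) j l \<and> list_all2 (\<le>) j' l \<and>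
       homotopic X (obj I l) (bond I j l \<circ> f) (bond I j' l \<circ> f')}"

definition ind_classes ::
  "('h, 'a) alg \<Rightarrow> ('h, 'a) ind_alg \<Rightarrow> (nat list \<times> (('h, 'a) univ \<Rightarrow> ('h, 'a) univ)) set set" where
  "ind_classes X I = {ind_class X I j f | j f. (j, f) \<in> ind_homs X I}"

subsection \<open>Morphisms and products\<close>

text \<open>
  Elements of \<open>{J\<^sup>n(A), B\<^bsup>\<S>\<^sup>n\<^esup>}\<close> have representatives \<open>(k # ps, f)\<close>, where \<open>f\<close>
  is a homomorphism from \<open>J\<^sup>n(A)\<close> to \<open>stab k (spheres ps B)\<close>.
\<close>

abbreviation stage_ind :: "nat \<Rightarrow> ('h, 'a) alg \<Rightarrow> ('h, 'a) ind_alg" where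
  "stage_ind n B \<equiv> ind_stab (ind_spheres n B)"

definition stage_homs ::
  "nat \<Rightarrow> ('h, 'a) alg \<Rightarrow> ('h, 'a) alg \<Rightarrow> (nat list \<times> (('h, 'a) univ \<Rightarrow> ('h, 'a) univ)) set" where
  "stage_homs n A B = ind_homs ((J ^^ n) A) (stage_ind n B)"

definition stage_class ::
  "nat \<Rightarrow> ('h, 'a) alg \<Rightarrow> ('h, 'a) alg \<Rightarrow> nat list \<Rightarrow> (('h, 'a) univ \<Rightarrow> ('h, 'a) univ)
    \<Rightarrow> (nat list \<times> (('h, 'a) univ \<Rightarrow> ('h, 'a) univ)) set" where
  "stage_class n A B = ind_class ((J ^^ n) A) (stage_ind n B)"

definition stage ::
  "nat \<Rightarrow> ('h, 'a) alg \<Rightarrow> ('h, 'a) alg \<Rightarrow> (nat list \<times> (('h, 'a) univ \<Rightarrow> ('h, 'a) univ)) set set" where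
  "stage n A B = ind_classes ((J ^^ n) A) (stage_ind n B)"

definition transition_hom ::
  "('h, 'a) alg \<Rightarrow> nat \<Rightarrow> nat list \<Rightarrow> (('h, 'a) univ \<Rightarrow> ('h, 'a) univ) \<Rightarrow> ('h, 'a) univ \<Rightarrow> ('h, 'a) univ" where
  "transition_hom B k ps f =
     stab_map (rho (spheres ps B)) \<circ>
     gamma (stab k) (\<lambda>_. stab_map) (spheres ps B) \<circ>
     T_map (stab k (spheres ps B)) f"

definition transition ::
  "('h, 'a) alg \<Rightarrow> ('h, 'a) alg \<Rightarrow> nat \<Rightarrow> (nat list \<times> (('h, 'a) univ \<Rightarrow> ('h, 'a) univ)) set
    \<Rightarrow> (nat list \<times> (('h, 'a) univ \<Rightarrow> ('h, 'a) univ)) set" where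
  "transition A B n x =
     (\<Union>(j, f)\<in>x. stage_class (Suc n) A B (hd j # 0 # tl j) (transition_hom B (hd j) (tl j) f))"

primrec transitions ::
  "('h, 'a) alg \<Rightarrow> ('h, 'a) alg \<Rightarrow> nat \<Rightarrow> nat \<Rightarrow> (nat list \<times> (('h, 'a) univ \<Rightarrow> ('h, 'a) univ)) set
    \<Rightarrow> (nat list \<times> (('h, 'a) univ \<Rightarrow> ('h, 'a) univ)) set" where
  "transitions A B n 0 x = x"
| "transitions A B n (Suc i) x = transition A B (n + i) (transitions A B n i x)"

definition kk_class ::
  "('h, 'a) alg \<Rightarrow> ('h, 'a) alg \<Rightarrow> nat \<Rightarrow> (nat list \<times> (('h, 'a) univ \<Rightarrow> ('h, 'a) univ)) set
    \<Rightarrow> ('h, 'a) kk_element" where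
  "kk_class A B n x = {(m, y). y \<in> stage m A B \<and>
     (\<exists>k. n \<le> k \<and> m \<le> k \<and> transitions A B n (k - n) x = transitions A B m (k - m) y)}"

definition kk :: "('h, 'a) alg \<Rightarrow> ('h, 'a) alg \<Rightarrow> ('h, 'a) kk_element set" where
  "kk A B = {kk_class A B n x | n x. x \<in> stage n A B}"

definition kk_rep ::
  "('h, 'a) alg \<Rightarrow> ('h, 'a) alg \<Rightarrow> nat \<Rightarrow> nat list \<Rightarrow> (('h, 'a) univ \<Rightarrow> ('h, 'a) univ) \<Rightarrow> ('h, 'a) kk_element" where
  "kk_rep A B n j f = kk_class A B n (stage_class n A B j f)"

definition j_class ::
  "('h, 'a) alg \<Rightarrow> ('h, 'a) alg \<Rightarrow> (('h, 'a) univ \<Rightarrow> ('h, 'a) univ) \<Rightarrow> ('h, 'a) kk_element" where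
  "j_class A B f = kk_rep A B 0 [1] (stab_corner B \<circ> f)"

definition kk_zero :: "('h, 'a) alg \<Rightarrow> ('h, 'a) alg \<Rightarrow> ('h, 'a) kk_element" where
  "kk_zero A B = j_class A B (\<lambda>_. \<zero>\<^bsub>B\<^esub>)"

definition kk_add ::
  "('h, 'a) alg \<Rightarrow> ('h, 'a) alg \<Rightarrow> ('h, 'a) kk_element \<Rightarrow> ('h, 'a) kk_element \<Rightarrow> ('h, 'a) kk_element" where
  "kk_add A B x y = \<Union>{kk_rep A B n ((k + l) # ps)
        (\<lambda>a. block_sum (mat_alg UNIV (spheres ps B)) k (f a) (g a)) | n k l ps f g.
      (k # ps, f) \<in> stage_homs n A B \<and> kk_rep A B n (k # ps) f = x \<and>
      (l # ps, g) \<in> stage_homs n A B \<and> kk_rep A B n (l # ps) g = y}"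

definition kk_uminus ::
  "('h, 'a) alg \<Rightarrow> ('h, 'a) alg \<Rightarrow> ('h, 'a) kk_element \<Rightarrow> ('h, 'a) kk_element" where
  "kk_uminus A B x = (THE y. y \<in> kk A B \<and> kk_add A B x y = kk_zero A B)"

text \<open>
  For \<open>f : J\<^sup>n(B) \<rightarrow> stab k (spheres ps C)\<close> and \<open>g : J\<^sup>m(A) \<rightarrow> stab l (spheres qs B)\<close>, with
  \<open>n = length ps\<close>, the composite
  \<open>J\<^sup>n\<^sup>+\<^sup>m(A) \<rightarrow> stab (prod_encode (l, k)) (spheres (qs @ ps) C)\<close>.
\<close>

definition product_hom ::
  "('h, 'a) alg \<Rightarrow> ('h, 'a) alg
    \<Rightarrow> nat \<Rightarrow> nat list \<Rightarrow> (('h, 'a) univ \<Rightarrow> ('h, 'a) univ)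
    \<Rightarrow> nat \<Rightarrow> nat list \<Rightarrow> (('h, 'a) univ \<Rightarrow> ('h, 'a) univ) \<Rightarrow> ('h, 'a) univ \<Rightarrow> ('h, 'a) univ" where
  "product_hom B C k ps f l qs g =
    (let n = length ps in
     mat_combine \<circ>
     stab_map (swap_stab qs (spheres ps C) \<circ>
               spheres_map qs (stab k (spheres ps C)) f \<circ>
               gamma_iter n (spheres qs) (spheres_map qs) B) \<circ>
     gamma_iter n (stab l) (\<lambda>_. stab_map) (spheres qs B) \<circ>
     J_iter_map n (stab l (spheres qs B)) g)"

text \<open>
  \<open>kk_product A B C x y z\<close> says that \<open>z \<in> kk(A, C)\<close> is the product of \<open>x \<in> kk(B, C)\<close> and
  \<open>y \<in> kk(A, B)\<close>. The class of the composite is independent of the representatives.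
\<close>

definition kk_product ::
  "('h, 'a) alg \<Rightarrow> ('h, 'a) alg \<Rightarrow> ('h, 'a) alg
    \<Rightarrow> ('h, 'a) kk_element \<Rightarrow> ('h, 'a) kk_element \<Rightarrow> ('h, 'a) kk_element \<Rightarrow> bool" where
  "kk_product A B C x y z \<longleftrightarrow>
    (\<exists>n m k l ps qs f g.
       (k # ps, f) \<in> stage_homs n B C \<and> x = kk_rep B C n (k # ps) f \<and>
       (l # qs, g) \<in> stage_homs m A B \<and> y = kk_rep A B m (l # qs) g \<and>
       (let c = kk_rep A C (n + m) (prod_encode (l, k) # qs @ ps) (product_hom B C k ps f l qs g)
        in z = (if even (m * n) then c else kk_uminus A C c)))"

definition kk_equivalence ::
  "('h, 'a) alg \<Rightarrow> ('h, 'a) alg \<Rightarrow> (('h, 'a) univ \<Rightarrow> ('h, 'a) univ) \<Rightarrow> bool" where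
  "kk_equivalence A B f \<longleftrightarrow> alg_hom A B f \<and>
    (\<exists>g\<in>kk B A. kk_product A B A g (j_class A B f) (j_class A A (\<lambda>x. x)) \<and>
                kk_product B A B (j_class A B f) g (j_class B B (\<lambda>x. x)))"

end

end

theory Submission
  imports Defs
begin

text \<open>
  The inclusion \<open>i : A\<^sub>0 \<rightarrow> A\<close> is a homotopy equivalence, and \<open>j\<close> turns homotopy equivalences into
  isomorphisms. The homotopy inverse is the projection \<open>p : A \<rightarrow> A\<^sub>0\<close> to the component of degree 0,
  which is multiplicative because no two components of positive degree, nor one of positive degree and
  one of degree 0, multiply into degree 0. Here \<open>p \<circ> i\<close> is the identity, while the homomorphism
  \<open>A \<rightarrow> A[t]\<close> sending \<open>a\<close> of degree \<open>n\<close> to \<open>a t\<^sup>n\<close> evaluates to \<open>i \<circ> p\<close> at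
  \<open>t = 0\<close> and to the identity at \<open>t = 1\<close> (\<open>graded_elem_homotopic\<close>). It is multiplicative because
  degrees add up in products, which is \<open>component_mult\<close>.

  It remains to see that \<open>j\<close> is functorial and invariant under homotopy, which \<open>kk_product_j_class\<close>
  states in one go. The class of a homomorphism \<open>f : X \<rightarrow> Y\<close> lives in \<open>{X, Y}\<close>, the stage of the colimit
  without loops, where neither \<open>J\<close> nor \<open>\<rho>\<close>, \<open>\<gamma>\<close> or signs enter: it is represented by \<open>f\<close> followed by
  the inclusion of \<open>Y\<close> as the upper left entry. The tensor product of two matrices concentrated in
  the upper left entry is again such a matrix, so the product of the classes of \<open>g\<close> and \<open>f\<close> is represented
  by \<open>g \<circ> f\<close> followed by the same inclusion (\<open>product_hom_stab_corner\<close>), only into matrices of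
  a larger size; the colimit over the sizes removes this difference. Finally, a homotopy between
  homomorphisms to \<open>Y\<close> can be pushed forward to matrices over \<open>Y\<close> (\<open>elem_homotopic_postcomp\<close>).
\<close>


section \<open>Additive maps and multiplication by zero\<close>

lemma additive_zero:
  assumes "abelian_group X" "abelian_group Y" and f: "f \<in> carrier X \<rightarrow> carrier Y"
    and add: "\<And>x y. \<lbrakk>x \<in> carrier X; y \<in> carrier X\<rbrakk> \<Longrightarrow> f (x \<oplus>\<^bsub>X\<^esub> y) = f x \<oplus>\<^bsub>Y\<^esub> f y"
  shows "f \<zero>\<^bsub>X\<^esub> = \<zero>\<^bsub>Y\<^esub>"
proof -
  interpret X: abelian_group X by fact
  interpret Y: abelian_group Y by fact
  have c: "f \<zero>\<^bsub>X\<^esub> \<in> carrier Y" using f by auto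
  have "f \<zero>\<^bsub>X\<^esub> \<oplus>\<^bsub>Y\<^esub> f \<zero>\<^bsub>X\<^esub> = f \<zero>\<^bsub>X\<^esub>"
    using add[of "\<zero>\<^bsub>X\<^esub>" "\<zero>\<^bsub>X\<^esub>"] by simp
  then show ?thesis using c by (metis Y.add.l_cancel_one')
qed

lemma additive_finsum:
  assumes "abelian_group X" "abelian_group Y" and f: "f \<in> carrier X \<rightarrow> carrier Y"
    and add: "\<And>x y. \<lbrakk>x \<in> carrier X; y \<in> carrier X\<rbrakk> \<Longrightarrow> f (x \<oplus>\<^bsub>X\<^esub> y) = f x \<oplus>\<^bsub>Y\<^esub> f y"
    and g: "g \<in> S \<rightarrow> carrier X"
  shows "f (finsum X g S) = finsum Y (\<lambda>i. f (g i)) S"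
proof -
  interpret X: abelian_group X by fact
  interpret Y: abelian_group Y by fact
  have zero: "f \<zero>\<^bsub>X\<^esub> = \<zero>\<^bsub>Y\<^esub>" using additive_zero[OF assms(1-4)] by blast
  show ?thesis using g
  proof (induct S rule: infinite_finite_induct)
    case (insert i S)
    then have "(\<lambda>i. f (g i)) \<in> S \<rightarrow> carrier Y" "f (g i) \<in> carrier Y" "g i \<in> carrier X"
      "g \<in> S \<rightarrow> carrier X" using f by auto
    then show ?case using insert by (simp add: add)
  qed (simp_all add: zero)
qed

context halgebra
begin

lemma zero_mult: "x \<in> carrier A \<Longrightarrow> \<zero>\<^bsub>A\<^esub> \<otimes>\<^bsub>A\<^esub> x = \<zero>\<^bsub>A\<^esub>"
  by (rule additive_zero[of A A "\<lambda>y. y \<otimes>\<^bsub>A\<^esub> x"])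
    (auto simp: A.abelian_group_axioms mult_closed l_distr)

lemma mult_zero: "x \<in> carrier A \<Longrightarrow> x \<otimes>\<^bsub>A\<^esub> \<zero>\<^bsub>A\<^esub> = \<zero>\<^bsub>A\<^esub>"
  by (rule additive_zero[of A A "\<lambda>y. x \<otimes>\<^bsub>A\<^esub> y"])
    (auto simp: A.abelian_group_axioms mult_closed r_distr)

lemma lact_zero: "h \<in> carrier H \<Longrightarrow> lact A h \<zero>\<^bsub>A\<^esub> = \<zero>\<^bsub>A\<^esub>"
  by (rule additive_zero[of A A "lact A h"])
    (auto simp: A.abelian_group_axioms lact_closed lact_add)

lemma ract_zero: "h \<in> carrier H \<Longrightarrow> ract A \<zero>\<^bsub>A\<^esub> h = \<zero>\<^bsub>A\<^esub>"
  by (rule additive_zero[of A A "\<lambda>x. ract A x h"])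
    (auto simp: A.abelian_group_axioms ract_closed ract_add)

text \<open>
  The left hand side is the coefficient of \<open>t\<^sup>n\<close> in the product of the monomials \<open>x t\<^sup>p\<close> and
  \<open>y t\<^sup>q\<close>. Constant polynomials and homogeneous elements are both handled by it.
\<close>

lemma antidiagonal_single:
  fixes n p q :: nat
  assumes "x \<in> carrier A" "y \<in> carrier A"
  shows "(\<Oplus>\<^bsub>A\<^esub>i\<in>{..n}. (if i = p then x else \<zero>\<^bsub>A\<^esub>) \<otimes>\<^bsub>A\<^esub> (if n - i = q then y else \<zero>\<^bsub>A\<^esub>))
    = (if n = p + q then x \<otimes>\<^bsub>A\<^esub> y else \<zero>\<^bsub>A\<^esub>)"
proof -
  have eq: "(if i = p then x else \<zero>\<^bsub>A\<^esub>) \<otimes>\<^bsub>A\<^esub> (if n - i = q then y else \<zero>\<^bsub>A\<^esub>)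
      = (if p = i then (if n = p + q then x \<otimes>\<^bsub>A\<^esub> y else \<zero>\<^bsub>A\<^esub>) else \<zero>\<^bsub>A\<^esub>)" if "i \<in> {..n}" for i
  proof (cases "p = i")
    case True
    then have "n - i = q \<longleftrightarrow> n = p + q" using that by auto
    then show ?thesis using True assms by (simp add: mult_zero)
  qed (use assms in \<open>simp add: zero_mult\<close>)
  have "(\<Oplus>\<^bsub>A\<^esub>i\<in>{..n}. (if i = p then x else \<zero>\<^bsub>A\<^esub>) \<otimes>\<^bsub>A\<^esub> (if n - i = q then y else \<zero>\<^bsub>A\<^esub>))
    = (\<Oplus>\<^bsub>A\<^esub>i\<in>{..n}. if p = i then (if n = p + q then x \<otimes>\<^bsub>A\<^esub> y else \<zero>\<^bsub>A\<^esub>) else \<zero>\<^bsub>A\<^esub>)"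
    using assms by (intro A.finsum_cong') (auto simp: eq mult_closed)
  also have "\<dots> = (if n = p + q then x \<otimes>\<^bsub>A\<^esub> y else \<zero>\<^bsub>A\<^esub>)"
  proof (cases "p \<le> n")
    case True
    then show ?thesis
      using assms A.add.finprod_singleton[of p "{..n}" "\<lambda>_. if n = p + q then x \<otimes>\<^bsub>A\<^esub> y else \<zero>\<^bsub>A\<^esub>"]
      by (simp add: mult_closed)
  next
    case False
    then have "(\<Oplus>\<^bsub>A\<^esub>i\<in>{..n}. if p = i then (if n = p + q then x \<otimes>\<^bsub>A\<^esub> y else \<zero>\<^bsub>A\<^esub>) else \<zero>\<^bsub>A\<^esub>)
        = (\<Oplus>\<^bsub>A\<^esub>i\<in>{..n}. \<zero>\<^bsub>A\<^esub>)"
      by (intro A.finsum_cong') auto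
    then show ?thesis using False by simp
  qed
  finally show ?thesis .
qed

end


section \<open>Homogeneous components\<close>

context nat_graded_halgebra
begin

lemma degree_closed: "x \<in> G n \<Longrightarrow> x \<in> carrier A"
  using subgroup.subset[OF degree_subgroup[of n]] by auto

lemma degree_zero: "\<zero>\<^bsub>A\<^esub> \<in> G n"
  using subgroup.one_closed[OF degree_subgroup[of n]] by simp

lemma degree_add: "\<lbrakk>x \<in> G n; y \<in> G n\<rbrakk> \<Longrightarrow> x \<oplus>\<^bsub>A\<^esub> y \<in> G n"
  using subgroup.m_closed[OF degree_subgroup[of n]] by simp

definition component :: "'u \<Rightarrow> nat \<Rightarrow> 'u" where
  "component x = (THE f. (\<forall>n. f n \<in> G n) \<and> finite {n. f n \<noteq> \<zero>\<^bsub>A\<^esub>} \<and>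
     x = (\<Oplus>\<^bsub>A\<^esub>n\<in>{n. f n \<noteq> \<zero>\<^bsub>A\<^esub>}. f n))"

lemma
  assumes "x \<in> carrier A"
  shows component_degree: "component x n \<in> G n"
    and finite_components: "finite {n. component x n \<noteq> \<zero>\<^bsub>A\<^esub>}"
    and sum_components: "(\<Oplus>\<^bsub>A\<^esub>n\<in>{n. component x n \<noteq> \<zero>\<^bsub>A\<^esub>}. component x n) = x"
proof -
  note props = theI'[OF direct_sum[OF assms], folded component_def]
  show "component x n \<in> G n" "finite {n. component x n \<noteq> \<zero>\<^bsub>A\<^esub>}"
    using props by blast+
  show "(\<Oplus>\<^bsub>A\<^esub>n\<in>{n. component x n \<noteq> \<zero>\<^bsub>A\<^esub>}. component x n) = x"
    by (rule props[THEN conjunct2, THEN conjunct2, symmetric])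
qed

lemma component_closed: "x \<in> carrier A \<Longrightarrow> component x n \<in> carrier A"
  using component_degree degree_closed by blast

lemma sum_components_superset:
  assumes "x \<in> carrier A" "finite S" "{n. component x n \<noteq> \<zero>\<^bsub>A\<^esub>} \<subseteq> S"
  shows "(\<Oplus>\<^bsub>A\<^esub>n\<in>S. component x n) = x"
proof -
  have "(\<Oplus>\<^bsub>A\<^esub>n\<in>{n. component x n \<noteq> \<zero>\<^bsub>A\<^esub>}. component x n) = (\<Oplus>\<^bsub>A\<^esub>n\<in>S. component x n)"
    by (rule A.add.finprod_mono_neutral_cong_left) (use assms component_closed in auto)
  then show ?thesis by (simp only: sum_components[OF assms(1)])
qed

lemma component_eqI:
  assumes f: "\<And>n. f n \<in> G n" and S: "finite S" "{n. f n \<noteq> \<zero>\<^bsub>A\<^esub>} \<subseteq> S"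
    and x: "x = (\<Oplus>\<^bsub>A\<^esub>n\<in>S. f n)"
  shows "component x = f"
proof -
  have c: "f n \<in> carrier A" for n using f degree_closed by blast
  have sum: "x = (\<Oplus>\<^bsub>A\<^esub>n\<in>{n. f n \<noteq> \<zero>\<^bsub>A\<^esub>}. f n)"
    unfolding x by (rule A.add.finprod_mono_neutral_cong_right) (use S c in auto)
  have "x \<in> carrier A" unfolding x using c by (intro A.finsum_closed) auto
  then show ?thesis
    unfolding component_def using f finite_subset[OF S(2,1)] sum
    by (intro the1_equality[OF direct_sum]) blast+
qed

lemma component_add:
  assumes "x \<in> carrier A" "y \<in> carrier A"
  shows "component (x \<oplus>\<^bsub>A\<^esub> y) n = component x n \<oplus>\<^bsub>A\<^esub> component y n"
proof -
  let ?S = "{n. component x n \<noteq> \<zero>\<^bsub>A\<^esub>} \<union> {n. component y n \<noteq> \<zero>\<^bsub>A\<^esub>}"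
  have fin: "finite ?S" using assms finite_components by auto
  have "x \<oplus>\<^bsub>A\<^esub> y = (\<Oplus>\<^bsub>A\<^esub>n\<in>?S. component x n) \<oplus>\<^bsub>A\<^esub> (\<Oplus>\<^bsub>A\<^esub>n\<in>?S. component y n)"
    using sum_components_superset assms fin by simp
  also have "\<dots> = (\<Oplus>\<^bsub>A\<^esub>n\<in>?S. component x n \<oplus>\<^bsub>A\<^esub> component y n)"
    using assms by (intro A.finsum_addf[symmetric]) (auto simp: component_closed)
  finally have "component (x \<oplus>\<^bsub>A\<^esub> y) = (\<lambda>n. component x n \<oplus>\<^bsub>A\<^esub> component y n)"
    using assms fin by (intro component_eqI[where S = ?S]) (auto intro: degree_add component_degree)
  then show ?thesis by simp
qed

lemma component_homogeneous:
  assumes "x \<in> G m"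
  shows "component x n = (if n = m then x else \<zero>\<^bsub>A\<^esub>)"
proof -
  have "component x = (\<lambda>n. if n = m then x else \<zero>\<^bsub>A\<^esub>)"
    using assms by (intro component_eqI[where S = "{m}"]) (auto simp: degree_zero degree_closed)
  then show ?thesis by simp
qed

text \<open>
  An identity between additive expressions in \<open>x\<close> need only be checked for homogeneous \<open>x\<close>. This
  avoids all manipulation of double sums below.
\<close>

lemma homogeneous_induct [consumes 1, case_names homogeneous add]:
  assumes "x \<in> carrier A" and hom: "\<And>n x. x \<in> G n \<Longrightarrow> P x"
    and add: "\<And>x y. \<lbrakk>x \<in> carrier A; y \<in> carrier A; P x; P y\<rbrakk> \<Longrightarrow> P (x \<oplus>\<^bsub>A\<^esub> y)"
  shows "P x"
proof -
  have "P (\<Oplus>\<^bsub>A\<^esub>n\<in>S. component x n)" if "finite S" for S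
    using that
  proof induct
    case empty
    then show ?case using hom[OF degree_zero] by simp
  next
    case (insert n S)
    have c: "component x \<in> S \<rightarrow> carrier A" using assms(1) component_closed by auto
    then have "P (component x n \<oplus>\<^bsub>A\<^esub> (\<Oplus>\<^bsub>A\<^esub>n\<in>S. component x n))"
      using insert assms(1) hom[OF component_degree]
      by (intro add) (simp_all add: component_closed)
    then show ?case using c insert assms(1) by (simp add: component_closed)
  qed
  from this[OF finite_components[OF assms(1)]] show ?thesis by (simp only: sum_components[OF assms(1)])
qed

lemma component_lact:
  assumes "x \<in> carrier A" "h \<in> carrier H"
  shows "component (lact A h x) n = lact A h (component x n)"
  using assms(1)
proof (induct rule: homogeneous_induct)
  case (homogeneous m x)
  then show ?case using component_homogeneous[OF degree_lact[OF assms(2)]] assms(2)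
    by (simp add: component_homogeneous lact_zero)
next
  case (add x y)
  then show ?case using assms(2) by (simp add: lact_add component_add lact_closed component_closed)
qed

lemma component_ract:
  assumes "x \<in> carrier A" "h \<in> carrier H"
  shows "component (ract A x h) n = ract A (component x n) h"
  using assms(1)
proof (induct rule: homogeneous_induct)
  case (homogeneous m x)
  then show ?case using component_homogeneous[OF degree_ract[OF assms(2)]] assms(2)
    by (simp add: component_homogeneous ract_zero)
next
  case (add x y)
  then show ?case using assms(2) by (simp add: ract_add component_add ract_closed component_closed)
qed

text \<open>
  The components of a product form the Cauchy product of the components of the factors, so that
  \<open>x \<mapsto> \<Sum>\<^sub>n x\<^sub>n t\<^sup>n\<close> is multiplicative. Both sides are biadditive, and for homogeneous factors
  at most one summand is nonzero.
\<close>

lemma component_mult: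
  assumes "x \<in> carrier A" "y \<in> carrier A"
  shows "component (x \<otimes>\<^bsub>A\<^esub> y) n = (\<Oplus>\<^bsub>A\<^esub>i\<in>{..n}. component x i \<otimes>\<^bsub>A\<^esub> component y (n - i))"
  using assms(1)
proof (induct rule: homogeneous_induct)
  case x: (homogeneous p x)
  from assms(2) show ?case
  proof (induct rule: homogeneous_induct)
    case (homogeneous q y)
    show ?case
      unfolding component_homogeneous[OF x] component_homogeneous[OF homogeneous]
        component_homogeneous[OF degree_mult[OF x homogeneous]]
      by (rule antidiagonal_single[OF degree_closed[OF x] degree_closed[OF homogeneous], symmetric])
  next
    case (add y z)
    have "component (x \<otimes>\<^bsub>A\<^esub> (y \<oplus>\<^bsub>A\<^esub> z)) n
        = component (x \<otimes>\<^bsub>A\<^esub> y) n \<oplus>\<^bsub>A\<^esub> component (x \<otimes>\<^bsub>A\<^esub> z) n"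
      using add degree_closed[OF x] by (simp add: r_distr component_add mult_closed)
    also have "\<dots> = (\<Oplus>\<^bsub>A\<^esub>i\<in>{..n}. component x i \<otimes>\<^bsub>A\<^esub> component y (n - i)
        \<oplus>\<^bsub>A\<^esub> component x i \<otimes>\<^bsub>A\<^esub> component z (n - i))"
      unfolding add(3) add(4) using add degree_closed[OF x]
      by (intro A.finsum_addf[symmetric]) (auto simp: component_closed mult_closed)
    also have "\<dots> = (\<Oplus>\<^bsub>A\<^esub>i\<in>{..n}. component x i \<otimes>\<^bsub>A\<^esub> component (y \<oplus>\<^bsub>A\<^esub> z) (n - i))"
      using add degree_closed[OF x] by (intro A.finsum_cong')
        (auto simp: component_closed mult_closed component_add r_distr)
    finally show ?case .
  qed
next
  case (add x z)
  have "component ((x \<oplus>\<^bsub>A\<^esub> z) \<otimes>\<^bsub>A\<^esub> y) n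
      = component (x \<otimes>\<^bsub>A\<^esub> y) n \<oplus>\<^bsub>A\<^esub> component (z \<otimes>\<^bsub>A\<^esub> y) n"
    using add assms(2) by (simp add: l_distr component_add mult_closed)
  also have "\<dots> = (\<Oplus>\<^bsub>A\<^esub>i\<in>{..n}. component x i \<otimes>\<^bsub>A\<^esub> component y (n - i)
      \<oplus>\<^bsub>A\<^esub> component z i \<otimes>\<^bsub>A\<^esub> component y (n - i))"
    unfolding add(3) add(4) using add assms(2)
    by (intro A.finsum_addf[symmetric]) (auto simp: component_closed mult_closed)
  also have "\<dots> = (\<Oplus>\<^bsub>A\<^esub>i\<in>{..n}. component (x \<oplus>\<^bsub>A\<^esub> z) i \<otimes>\<^bsub>A\<^esub> component y (n - i))"
    using add assms(2) by (intro A.finsum_cong')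
      (auto simp: component_closed mult_closed component_add l_distr)
  finally show ?case .
qed

lemma halgebra_degree_zero: "halgebra H (A\<lparr>carrier := G 0\<rparr>)"
proof -
  have "group ((add_monoid A)\<lparr>carrier := G 0\<rparr>)"
    by (rule subgroup.subgroup_is_group[OF degree_subgroup]) (rule A.add.group_axioms)
  then have "comm_group ((add_monoid A)\<lparr>carrier := G 0\<rparr>)"
    by (rule group.group_comm_groupI) (auto simp: degree_closed A.a_comm)
  then have "abelian_group (A\<lparr>carrier := G 0\<rparr>)"
    by (intro comm_group_abelian_groupI) simp
  moreover have "x \<in> G 0 \<Longrightarrow> y \<in> G 0 \<Longrightarrow> x \<otimes>\<^bsub>A\<^esub> y \<in> G 0" for x y
    using degree_mult[of x 0 y 0] by simp
  moreover have "x \<in> G 0 \<Longrightarrow> x \<in> carrier A" for x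
    by (rule degree_closed)
  ultimately show ?thesis
    using H.ring_axioms
    by (intro halgebra.intro halgebra_axioms.intro)
      (simp_all add: mult_assoc l_distr r_distr degree_lact lact_add add_lact lact_lact
        lact_one degree_ract ract_add add_ract ract_ract ract_one lact_ract lact_mult ract_mult balanced)
qed

end


section \<open>Elementary homotopies\<close>

definition poly_map :: "(('h, 'a) univ \<Rightarrow> ('h, 'a) univ) \<Rightarrow> ('h, 'a) univ \<Rightarrow> ('h, 'a) univ" where
  "poly_map f p = Poly (\<lambda>n. f (coeff p n))"

context kk_theory
begin

lemma alg_hom_zero:
  assumes "alg_hom X Y f" "abelian_group X" "abelian_group Y"
  shows "f \<zero>\<^bsub>X\<^esub> = \<zero>\<^bsub>Y\<^esub>"
  using assms by (intro additive_zero) (auto simp: alg_hom_def)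

lemma alg_hom_comp: "\<lbrakk>alg_hom X Y f; alg_hom Y Z g\<rbrakk> \<Longrightarrow> alg_hom X Z (g \<circ> f)"
  unfolding alg_hom_def by (simp add: Pi_iff)

text \<open>
  Homomorphisms are total functions on a type, of which only the values on the carrier matter. Since
  they are nevertheless compared as functions, this and \<open>elem_homotopic_cong\<close> are needed to
  change them outside of the carrier.
\<close>

lemma alg_hom_cong:
  assumes "halgebra H X" "\<And>x. x \<in> carrier X \<Longrightarrow> f x = g x" "alg_hom X Y f"
  shows "alg_hom X Y g"
proof -
  interpret X: halgebra H X by fact
  show ?thesis using assms(3) unfolding alg_hom_def
    by (simp add: Pi_iff assms(2)[symmetric] X.mult_closed X.lact_closed X.ract_closed)
qed

text \<open>
  A coefficient of a product is a finite sum of products, on which \<open>f\<close> can be evaluated termwise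
  once these products are known to lie in \<open>X\<close>.
\<close>

lemma alg_hom_poly_map:
  assumes f: "alg_hom X Y f" and X: "abelian_group X" and Y: "abelian_group Y"
    and mult_closed: "\<And>x y. \<lbrakk>x \<in> carrier X; y \<in> carrier X\<rbrakk> \<Longrightarrow> x \<otimes>\<^bsub>X\<^esub> y \<in> carrier X"
  shows "alg_hom (poly_alg X) (poly_alg Y) (poly_map f)"
proof -
  interpret X: abelian_group X by fact
  interpret Y: abelian_group Y by fact
  have zero: "f \<zero>\<^bsub>X\<^esub> = \<zero>\<^bsub>Y\<^esub>"
    by (rule alg_hom_zero[OF f X Y])
  have closed: "poly_map f p \<in> carrier (poly_alg Y)" if "p \<in> carrier (poly_alg X)" for p
  proof -
    have "finite {n. f (coeff p n) \<noteq> \<zero>\<^bsub>Y\<^esub>}"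
      by (rule finite_subset[of _ "{n. coeff p n \<noteq> \<zero>\<^bsub>X\<^esub>}"])
        (use that zero in \<open>auto simp: poly_alg_def\<close>)
    moreover have "f (coeff p n) \<in> carrier Y" for n
      using that f by (fastforce simp: poly_alg_def alg_hom_def)
    ultimately show ?thesis by (auto simp: poly_alg_def poly_map_def)
  qed
  have sum: "f (\<Oplus>\<^bsub>X\<^esub>i\<in>{..n}. coeff p i \<otimes>\<^bsub>X\<^esub> coeff q (n - i))
      = (\<Oplus>\<^bsub>Y\<^esub>i\<in>{..n}. f (coeff p i) \<otimes>\<^bsub>Y\<^esub> f (coeff q (n - i)))"
    if "p \<in> carrier (poly_alg X)" "q \<in> carrier (poly_alg X)" for p q and n :: nat
  proof -
    have c: "coeff p i \<in> carrier X" "coeff q i \<in> carrier X" for i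
      using that by (auto simp: poly_alg_def)
    have "f (\<Oplus>\<^bsub>X\<^esub>i\<in>{..n}. coeff p i \<otimes>\<^bsub>X\<^esub> coeff q (n - i))
        = (\<Oplus>\<^bsub>Y\<^esub>i\<in>{..n}. f (coeff p i \<otimes>\<^bsub>X\<^esub> coeff q (n - i)))"
      by (rule additive_finsum[OF X Y])
        (use f c in \<open>auto simp: alg_hom_def mult_closed\<close>)
    then show ?thesis using f c by (simp add: alg_hom_def)
  qed
  have coeffs: "coeff p n \<in> carrier X" if "p \<in> carrier (poly_alg X)" for p n
    using that by (auto simp: poly_alg_def)
  show ?thesis
    unfolding alg_hom_def
  proof (intro conjI ballI)
    show "poly_map f \<in> carrier (poly_alg X) \<rightarrow> carrier (poly_alg Y)" using closed by auto
  next
    fix p q assume pq: "p \<in> carrier (poly_alg X)" "q \<in> carrier (poly_alg X)"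
    then show "poly_map f (p \<otimes>\<^bsub>poly_alg X\<^esub> q) = poly_map f p \<otimes>\<^bsub>poly_alg Y\<^esub> poly_map f q"
      using sum[OF pq] by (simp add: poly_alg_def poly_map_def)
    show "poly_map f (p \<oplus>\<^bsub>poly_alg X\<^esub> q) = poly_map f p \<oplus>\<^bsub>poly_alg Y\<^esub> poly_map f q"
      using f coeffs[OF pq(1)] coeffs[OF pq(2)] by (simp add: poly_alg_def poly_map_def alg_hom_def)
  next
    fix h p assume hp: "h \<in> carrier H" "p \<in> carrier (poly_alg X)"
    then show "poly_map f (lact (poly_alg X) h p) = lact (poly_alg Y) h (poly_map f p)"
      "poly_map f (ract (poly_alg X) p h) = ract (poly_alg Y) (poly_map f p) h"
      using f coeffs[OF hp(2)] by (simp_all add: poly_alg_def poly_map_def alg_hom_def)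
  qed
qed

text \<open>
  Applying \<open>k\<close> to the coefficients of a homotopy commutes with both evaluations; for the evaluation at
  1 this says that \<open>k\<close> commutes with finite sums.
\<close>

lemma elem_homotopic_postcomp:
  assumes "elem_homotopic X Y f g" and k: "alg_hom Y Z k" and Y: "abelian_group Y" and Z: "abelian_group Z"
    and mult_closed: "\<And>x y. \<lbrakk>x \<in> carrier Y; y \<in> carrier Y\<rbrakk> \<Longrightarrow> x \<otimes>\<^bsub>Y\<^esub> y \<in> carrier Y"
  shows "elem_homotopic X Z (k \<circ> f) (k \<circ> g)"
proof -
  interpret Y: abelian_group Y by fact
  interpret Z: abelian_group Z by fact
  obtain h where f: "alg_hom X Y f" and g: "alg_hom X Y g" and h: "alg_hom X (poly_alg Y) h"
    and ev: "\<And>x. x \<in> carrier X \<Longrightarrow> ev0 (h x) = f x \<and> ev1 Y (h x) = g x"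
    using assms(1) unfolding elem_homotopic_def by blast
  have zero: "k \<zero>\<^bsub>Y\<^esub> = \<zero>\<^bsub>Z\<^esub>" by (rule alg_hom_zero[OF k Y Z])
  have "ev1 Z (poly_map k p) = k (ev1 Y p)" if p: "p \<in> carrier (poly_alg Y)" for p
  proof -
    have c: "coeff p i \<in> carrier Y" for i using p by (auto simp: poly_alg_def)
    have fin: "finite {n. coeff p n \<noteq> \<zero>\<^bsub>Y\<^esub>}" using p by (auto simp: poly_alg_def)
    have "k (ev1 Y p) = (\<Oplus>\<^bsub>Z\<^esub>n\<in>{n. coeff p n \<noteq> \<zero>\<^bsub>Y\<^esub>}. k (coeff p n))"
      unfolding ev1_def by (rule additive_finsum[OF Y Z])
        (use k c in \<open>auto simp: alg_hom_def\<close>)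
    also have "\<dots> = (\<Oplus>\<^bsub>Z\<^esub>n\<in>{n. k (coeff p n) \<noteq> \<zero>\<^bsub>Z\<^esub>}. k (coeff p n))"
      by (rule Z.add.finprod_mono_neutral_cong_right[OF fin])
        (use k c zero in \<open>auto simp: alg_hom_def\<close>)
    finally show ?thesis by (simp add: ev1_def poly_map_def)
  qed
  moreover have "ev0 (poly_map k p) = k (ev0 p)" for p
    by (simp add: ev0_def poly_map_def)
  moreover have "h x \<in> carrier (poly_alg Y)" if "x \<in> carrier X" for x
    using h that by (auto simp: alg_hom_def)
  ultimately show ?thesis
    unfolding elem_homotopic_def
    using alg_hom_comp[OF f k] alg_hom_comp[OF g k]
      alg_hom_comp[OF h alg_hom_poly_map[OF k Y Z mult_closed]] ev
    by (intro conjI exI[of _ "poly_map k \<circ> h"]) auto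
qed

lemma elem_homotopic_cong:
  assumes "elem_homotopic X Y f g" "halgebra H X"
    and "\<And>x. x \<in> carrier X \<Longrightarrow> f x = f' x" "\<And>x. x \<in> carrier X \<Longrightarrow> g x = g' x"
  shows "elem_homotopic X Y f' g'"
  using assms alg_hom_cong[OF assms(2), of f f' Y] alg_hom_cong[OF assms(2), of g g' Y]
  unfolding elem_homotopic_def by auto

text \<open>
  The homotopy sends \<open>x\<close> to the constant polynomial \<open>f x\<close>.
\<close>

lemma elem_homotopic_refl:
  assumes f: "alg_hom X Y f" and Y: "halgebra H Y"
  shows "elem_homotopic X Y f f"
proof -
  interpret Y: halgebra H Y by fact
  define c where "c y = Poly (\<lambda>n. if n = 0 then y else \<zero>\<^bsub>Y\<^esub>)" for y
  have supp: "{n. (if n = 0 then y else \<zero>\<^bsub>Y\<^esub>) \<noteq> \<zero>\<^bsub>Y\<^esub>} \<subseteq> {0 :: nat}" for y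
    by auto
  have "alg_hom Y (poly_alg Y) c"
    unfolding alg_hom_def
  proof (intro conjI ballI)
    show "c \<in> carrier Y \<rightarrow> carrier (poly_alg Y)"
      using finite_subset[OF supp] by (auto simp: c_def poly_alg_def)
  next
    fix x y assume "x \<in> carrier Y" "y \<in> carrier Y"
    then have "(if n = 0 then x \<otimes>\<^bsub>Y\<^esub> y else \<zero>\<^bsub>Y\<^esub>) = (\<Oplus>\<^bsub>Y\<^esub>i\<in>{..n}.
        (if i = 0 then x else \<zero>\<^bsub>Y\<^esub>) \<otimes>\<^bsub>Y\<^esub> (if n - i = 0 then y else \<zero>\<^bsub>Y\<^esub>))" for n :: nat
      using Y.antidiagonal_single[where x = x and y = y and n = n and p = 0 and q = 0] by simp
    then show "c (x \<otimes>\<^bsub>Y\<^esub> y) = c x \<otimes>\<^bsub>poly_alg Y\<^esub> c y"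
      by (simp only: c_def poly_alg_def halgebra.simps ring.simps monoid.simps univ.sel)
  qed (auto simp: c_def poly_alg_def Y.lact_zero Y.ract_zero)
  moreover have "ev1 Y (c y) = y" if "y \<in> carrier Y" for y
    using that Y.A.add.finprod_mono_neutral_cong_left[OF _ supp[of y], of
        "\<lambda>n. if n = 0 then y else \<zero>\<^bsub>Y\<^esub>" "\<lambda>n. if n = 0 then y else \<zero>\<^bsub>Y\<^esub>"]
    by (simp add: c_def ev1_def)
  moreover have "ev0 (c y) = y" for y by (simp add: ev0_def c_def)
  moreover have "f x \<in> carrier Y" if "x \<in> carrier X" for x
    using f that by (auto simp: alg_hom_def)
  ultimately show ?thesis
    unfolding elem_homotopic_def using f alg_hom_comp[OF f, of "poly_alg Y" c]
    by (intro conjI exI[of _ "c \<circ> f"]) auto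
qed

end


section \<open>Matrices\<close>

lemma mat_algI:
  assumes "\<And>i j. m i j \<in> carrier X" "finite {(i, j). m i j \<noteq> \<zero>\<^bsub>X\<^esub>}"
    and "{(i, j). m i j \<noteq> \<zero>\<^bsub>X\<^esub>} \<subseteq> I \<times> I"
  shows "Mat m \<in> carrier (mat_alg I X)"
  using assms by (simp add: mat_alg_def)

lemma mat_algD:
  assumes "x \<in> carrier (mat_alg I X)"
  shows "entry x i j \<in> carrier X" "finite {(i, j). entry x i j \<noteq> \<zero>\<^bsub>X\<^esub>}"
    and "{(i, j). entry x i j \<noteq> \<zero>\<^bsub>X\<^esub>} \<subseteq> I \<times> I"
proof -
  obtain m where "x = Mat m" "\<forall>i j. m i j \<in> carrier X" "finite {(i, j). m i j \<noteq> \<zero>\<^bsub>X\<^esub>}"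
    "{(i, j). m i j \<noteq> \<zero>\<^bsub>X\<^esub>} \<subseteq> I \<times> I"
    using assms unfolding mat_alg_def by auto
  then show "entry x i j \<in> carrier X" "finite {(i, j). entry x i j \<noteq> \<zero>\<^bsub>X\<^esub>}"
    "{(i, j). entry x i j \<noteq> \<zero>\<^bsub>X\<^esub>} \<subseteq> I \<times> I" by simp_all
qed

lemma abelian_group_mat_alg:
  assumes "abelian_group X"
  shows "abelian_group (mat_alg I X)"
proof -
  interpret X: abelian_group X by fact
  \<comment> \<open>For \<open>f\<close> the addition or, ignoring the second argument, the negation of \<open>X\<close>.\<close>
  have closed: "Mat (\<lambda>i j. f (entry x i j) (entry y i j)) \<in> carrier (mat_alg I X)"
    if "x \<in> carrier (mat_alg I X)" "y \<in> carrier (mat_alg I X)"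
      and f: "f \<in> carrier X \<rightarrow> carrier X \<rightarrow> carrier X" "f \<zero>\<^bsub>X\<^esub> \<zero>\<^bsub>X\<^esub> = \<zero>\<^bsub>X\<^esub>" for f x y
  proof -
    have sub: "{(i, j). f (entry x i j) (entry y i j) \<noteq> \<zero>\<^bsub>X\<^esub>}
        \<subseteq> {(i, j). entry x i j \<noteq> \<zero>\<^bsub>X\<^esub>} \<union> {(i, j). entry y i j \<noteq> \<zero>\<^bsub>X\<^esub>}"
      using f(2) by auto
    have "finite ({(i, j). entry x i j \<noteq> \<zero>\<^bsub>X\<^esub>} \<union> {(i, j). entry y i j \<noteq> \<zero>\<^bsub>X\<^esub>})"
      "{(i, j). entry x i j \<noteq> \<zero>\<^bsub>X\<^esub>} \<union> {(i, j). entry y i j \<noteq> \<zero>\<^bsub>X\<^esub>} \<subseteq> I \<times> I"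
      using mat_algD(2,3)[OF that(1)] mat_algD(2,3)[OF that(2)] by simp_all
    with sub have "finite {(i, j). f (entry x i j) (entry y i j) \<noteq> \<zero>\<^bsub>X\<^esub>}"
      "{(i, j). f (entry x i j) (entry y i j) \<noteq> \<zero>\<^bsub>X\<^esub>} \<subseteq> I \<times> I"
      by (blast intro: finite_subset)+
    moreover have "f (entry x i j) (entry y i j) \<in> carrier X" for i j
      using mat_algD(1)[OF that(1)] mat_algD(1)[OF that(2)] f(1) by (simp add: Pi_iff)
    ultimately show ?thesis by (intro mat_algI)
  qed
  show ?thesis
  proof (rule abelian_groupI)
    fix x y assume "x \<in> carrier (mat_alg I X)" "y \<in> carrier (mat_alg I X)"
    from closed[OF this, of "(\<oplus>\<^bsub>X\<^esub>)"] show "x \<oplus>\<^bsub>mat_alg I X\<^esub> y \<in> carrier (mat_alg I X)"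
      by (simp add: mat_alg_def Pi_iff)
  next
    fix x assume x: "x \<in> carrier (mat_alg I X)"
    have "Mat (\<lambda>i j. \<ominus>\<^bsub>X\<^esub> entry x i j) \<in> carrier (mat_alg I X)"
      using closed[OF x x, of "\<lambda>x y. \<ominus>\<^bsub>X\<^esub> x"] by auto
    then show "\<exists>y\<in>carrier (mat_alg I X). y \<oplus>\<^bsub>mat_alg I X\<^esub> x = \<zero>\<^bsub>mat_alg I X\<^esub>"
      using x by (intro bexI[of _ "Mat (\<lambda>i j. \<ominus>\<^bsub>X\<^esub> entry x i j)"])
        (auto simp: mat_alg_def X.l_neg)
  next
    fix x y z assume "x \<in> carrier (mat_alg I X)" "y \<in> carrier (mat_alg I X)" "z \<in> carrier (mat_alg I X)"
    then show "x \<oplus>\<^bsub>mat_alg I X\<^esub> y \<oplus>\<^bsub>mat_alg I X\<^esub> z = x \<oplus>\<^bsub>mat_alg I X\<^esub> (y \<oplus>\<^bsub>mat_alg I X\<^esub> z)"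
      by (auto simp: mat_alg_def X.a_assoc)
  qed (auto simp: mat_alg_def X.a_comm)
qed

lemma corner_closed:
  assumes "\<zero>\<^bsub>X\<^esub> \<in> carrier X" "x \<in> carrier X" "0 \<in> I"
  shows "corner X x \<in> carrier (mat_alg I X)"
proof -
  let ?S = "{(i :: nat, j :: nat). (if i = 0 \<and> j = 0 then x else \<zero>\<^bsub>X\<^esub>) \<noteq> \<zero>\<^bsub>X\<^esub>}"
  have sub: "?S \<subseteq> {(0, 0)}" by auto
  have "finite ?S" by (rule finite_subset[OF sub]) simp
  moreover have "?S \<subseteq> I \<times> I" by (rule order_trans[OF sub]) (use assms(3) in simp)
  ultimately show ?thesis unfolding corner_def using assms(1,2) by (intro mat_algI) simp_all
qed

text \<open>
  The hypotheses only speak of \<open>x\<close> and \<open>y\<close>, so that the lemma can be applied a second time to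
  \<open>corner X x\<close> and \<open>corner X y\<close>, matrices for which they follow from the lemma itself.
\<close>

lemma corner_mult:
  assumes "abelian_group X" "x \<in> carrier X" "y \<in> carrier X" "x \<otimes>\<^bsub>X\<^esub> y \<in> carrier X"
    and "x \<otimes>\<^bsub>X\<^esub> \<zero>\<^bsub>X\<^esub> = \<zero>\<^bsub>X\<^esub>" "\<zero>\<^bsub>X\<^esub> \<otimes>\<^bsub>X\<^esub> y = \<zero>\<^bsub>X\<^esub>"
  shows "corner X x \<otimes>\<^bsub>mat_alg I X\<^esub> corner X y = corner X (x \<otimes>\<^bsub>X\<^esub> y)"
proof -
  interpret X: abelian_group X by fact
  have "(\<Oplus>\<^bsub>X\<^esub>l\<in>{l :: nat. (if i = 0 \<and> l = 0 then x else \<zero>\<^bsub>X\<^esub>) \<noteq> \<zero>\<^bsub>X\<^esub>}.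
      (if i = 0 \<and> l = 0 then x else \<zero>\<^bsub>X\<^esub>) \<otimes>\<^bsub>X\<^esub> (if l = 0 \<and> j = 0 then y else \<zero>\<^bsub>X\<^esub>))
      = (if i = 0 \<and> j = 0 then x \<otimes>\<^bsub>X\<^esub> y else \<zero>\<^bsub>X\<^esub>)" for i j :: nat
  proof (cases "i = 0 \<and> x \<noteq> \<zero>\<^bsub>X\<^esub>")
    case True
    then have "{l. (if i = 0 \<and> l = 0 then x else \<zero>\<^bsub>X\<^esub>) \<noteq> \<zero>\<^bsub>X\<^esub>} = {0 :: nat}" by auto
    then show ?thesis using True assms by simp
  next
    case False
    then have empty: "{l. (if i = 0 \<and> l = 0 then x else \<zero>\<^bsub>X\<^esub>) \<noteq> \<zero>\<^bsub>X\<^esub>} = ({} :: nat set)" by auto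
    show ?thesis unfolding empty using False assms(6) by auto
  qed
  then show ?thesis by (simp add: corner_def mat_alg_def)
qed

lemma mult_zero_mat_alg:
  assumes "abelian_group X" and "\<And>x. x \<in> carrier X \<Longrightarrow> x \<otimes>\<^bsub>X\<^esub> \<zero>\<^bsub>X\<^esub> = \<zero>\<^bsub>X\<^esub>"
    and x: "x \<in> carrier (mat_alg I X)"
  shows "x \<otimes>\<^bsub>mat_alg I X\<^esub> \<zero>\<^bsub>mat_alg I X\<^esub> = \<zero>\<^bsub>mat_alg I X\<^esub>"
proof -
  interpret X: abelian_group X by fact
  have "entry x i l \<otimes>\<^bsub>X\<^esub> \<zero>\<^bsub>X\<^esub> = \<zero>\<^bsub>X\<^esub>" for i l
    using assms(2) mat_algD(1)[OF x] by simp
  then show ?thesis by (simp add: mat_alg_def)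
qed

lemma mult_closed_mat_alg:
  assumes "abelian_group X"
    and mult_closed: "\<And>x y. \<lbrakk>x \<in> carrier X; y \<in> carrier X\<rbrakk> \<Longrightarrow> x \<otimes>\<^bsub>X\<^esub> y \<in> carrier X"
    and mult_zero: "\<And>x. x \<in> carrier X \<Longrightarrow> x \<otimes>\<^bsub>X\<^esub> \<zero>\<^bsub>X\<^esub> = \<zero>\<^bsub>X\<^esub>"
    and x: "x \<in> carrier (mat_alg I X)" and y: "y \<in> carrier (mat_alg I X)"
  shows "x \<otimes>\<^bsub>mat_alg I X\<^esub> y \<in> carrier (mat_alg I X)"
proof -
  interpret X: abelian_group X by fact
  let ?S = "{(i, j). entry x i j \<noteq> \<zero>\<^bsub>X\<^esub>}" and ?T = "{(i, j). entry y i j \<noteq> \<zero>\<^bsub>X\<^esub>}"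
  define z where "z i j = (\<Oplus>\<^bsub>X\<^esub>l\<in>{l. entry x i l \<noteq> \<zero>\<^bsub>X\<^esub>}. entry x i l \<otimes>\<^bsub>X\<^esub> entry y l j)" for i j
  have c: "entry x i j \<in> carrier X" "entry y i j \<in> carrier X" for i j
    using x y by (simp_all add: mat_algD)
  have fin: "finite ?S" "finite ?T" and sub: "?S \<subseteq> I \<times> I" "?T \<subseteq> I \<times> I"
    using mat_algD(2,3)[OF x] mat_algD(2,3)[OF y] by simp_all
  have supp: "{(i, j). z i j \<noteq> \<zero>\<^bsub>X\<^esub>} \<subseteq> fst ` ?S \<times> snd ` ?T"
  proof clarify
    fix i j assume nz: "z i j \<noteq> \<zero>\<^bsub>X\<^esub>"
    have "\<exists>l. entry x i l \<noteq> \<zero>\<^bsub>X\<^esub> \<and> entry y l j \<noteq> \<zero>\<^bsub>X\<^esub>"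
    proof (rule ccontr)
      assume "\<not> ?thesis"
      then have "z i j = (\<Oplus>\<^bsub>X\<^esub>l\<in>{l. entry x i l \<noteq> \<zero>\<^bsub>X\<^esub>}. \<zero>\<^bsub>X\<^esub>)"
        unfolding z_def by (intro X.finsum_cong') (auto simp: c mult_zero)
      then show False using nz by simp
    qed
    then show "i \<in> fst ` ?S \<and> j \<in> snd ` ?T" by force
  qed
  have "finite {(i, j). z i j \<noteq> \<zero>\<^bsub>X\<^esub>}"
    using finite_subset[OF supp] fin by simp
  moreover have "{(i, j). z i j \<noteq> \<zero>\<^bsub>X\<^esub>} \<subseteq> I \<times> I"
    using supp sub by fastforce
  moreover have "z i j \<in> carrier X" for i j
    unfolding z_def by (intro X.finsum_closed) (auto simp: c mult_closed)
  ultimately have "Mat z \<in> carrier (mat_alg I X)" by (intro mat_algI)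
  then show ?thesis by (simp add: mat_alg_def z_def[abs_def])
qed

lemma stab_carrier_mono: "k \<le> l \<Longrightarrow> carrier (stab k X) \<subseteq> carrier (stab l X)"
  unfolding stab_def mat_alg_def by fastforce

text \<open>
  Matrix algebras of different sizes have the same operations and differ in their carriers only, which
  makes the bonding maps of \<open>\<M>\<^sub>\<infinity>\<close> inclusions.
\<close>

lemma stab_ops:
  "add (stab k X) = add (stab l X)" "mult (stab k X) = mult (stab l X)"
  "zero (stab k X) = zero (stab l X)" "lact (stab k X) = lact (stab l X)"
  "ract (stab k X) = ract (stab l X)"
  by (simp_all add: stab_def mat_alg_def)

lemma abelian_group_stab: "abelian_group X \<Longrightarrow> abelian_group (stab k X)"
  by (simp add: stab_def abelian_group_mat_alg)

context kk_theory
begin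

lemma alg_hom_stab_corner:
  assumes X: "halgebra H X" and "0 < k"
  shows "alg_hom X (stab k X) (stab_corner X)"
proof -
  interpret X: halgebra H X by fact
  let ?M = "mat_alg UNIV X"
  have c: "corner X x \<in> carrier ?M" if "x \<in> carrier X" for x
    using that by (intro corner_closed) auto
  interpret M: abelian_group ?M by (rule abelian_group_mat_alg[OF X.A.abelian_group_axioms])
  have inner: "corner X x \<otimes>\<^bsub>?M\<^esub> corner X y = corner X (x \<otimes>\<^bsub>X\<^esub> y)"
    if "x \<in> carrier X" "y \<in> carrier X" for x y
    using that by (intro corner_mult X.A.abelian_group_axioms)
      (auto simp: X.mult_closed X.zero_mult X.mult_zero)
  have z: "\<zero>\<^bsub>?M\<^esub> = corner X \<zero>\<^bsub>X\<^esub>" by (simp add: mat_alg_def corner_def fun_eq_iff)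
  have outer: "stab_corner X x \<otimes>\<^bsub>stab k X\<^esub> stab_corner X y = stab_corner X (x \<otimes>\<^bsub>X\<^esub> y)"
    if "x \<in> carrier X" "y \<in> carrier X" for x y
    unfolding stab_corner_def stab_def inner[OF that, symmetric] using that
    by (intro corner_mult M.abelian_group_axioms)
      (auto simp: c inner z X.mult_closed X.zero_mult X.mult_zero)
  have closed: "stab_corner X x \<in> carrier (stab k X)" if "x \<in> carrier X" for x
    unfolding stab_corner_def stab_def using that assms(2) by (intro corner_closed c) auto
  show ?thesis
    unfolding alg_hom_def
  proof (intro conjI ballI)
    show "stab_corner X \<in> carrier X \<rightarrow> carrier (stab k X)" using closed by auto
  next
    fix x y assume "x \<in> carrier X" "y \<in> carrier X"
    then show "stab_corner X (x \<otimes>\<^bsub>X\<^esub> y) = stab_corner X x \<otimes>\<^bsub>stab k X\<^esub> stab_corner X y"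
      by (rule outer[symmetric])
  next
    fix x y assume "x \<in> carrier X" "y \<in> carrier X"
    then show "stab_corner X (x \<oplus>\<^bsub>X\<^esub> y) = stab_corner X x \<oplus>\<^bsub>stab k X\<^esub> stab_corner X y"
      by (simp add: stab_corner_def stab_def corner_def mat_alg_def fun_eq_iff)
  next
    fix h x assume "h \<in> carrier H" "x \<in> carrier X"
    then show "stab_corner X (lact X h x) = lact (stab k X) h (stab_corner X x)"
      "stab_corner X (ract X x h) = ract (stab k X) (stab_corner X x) h"
      by (simp_all add: stab_corner_def stab_def corner_def mat_alg_def fun_eq_iff
          X.lact_zero X.ract_zero)
  qed
qed

lemma alg_hom_stab_mono:
  assumes "alg_hom X (stab k Y) f" "k \<le> l"
  shows "alg_hom X (stab l Y) f"
proof -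
  have "f \<in> carrier X \<rightarrow> carrier (stab l Y)"
    using assms stab_carrier_mono[of k l Y] by (auto simp: alg_hom_def)
  then show ?thesis
    using assms(1) unfolding alg_hom_def stab_ops[of k Y l] by (elim conjE) (intro conjI)
qed

text \<open>
  The homotopy is composed with the inclusion into larger matrices. Although the two algebras of
  matrices share their addition, finite sums in them are defined relative to the carriers, so that
  passing from one to the other is an instance of compatibility with a homomorphism.
\<close>

lemma elem_homotopic_stab_mono:
  assumes "elem_homotopic X (stab k Y) f g" "k \<le> l" and Y: "halgebra H Y"
  shows "elem_homotopic X (stab l Y) f g"
proof -
  interpret Y: halgebra H Y by fact
  note M = abelian_group_mat_alg[OF Y.A.abelian_group_axioms]
  have "x \<otimes>\<^bsub>stab k Y\<^esub> y \<in> carrier (stab k Y)"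
    if "x \<in> carrier (stab k Y)" "y \<in> carrier (stab k Y)" for x y
    using that unfolding stab_def
    by (intro mult_closed_mat_alg M mult_zero_mat_alg)
      (auto simp: Y.mult_closed Y.mult_zero Y.A.abelian_group_axioms)
  moreover have "alg_hom (stab k Y) (stab l Y) (\<lambda>x. x)"
    by (rule alg_hom_stab_mono[of _ k]) (simp_all add: alg_hom_def assms(2))
  ultimately have "elem_homotopic X (stab l Y) ((\<lambda>x. x) \<circ> f) ((\<lambda>x. x) \<circ> g)"
    by (intro elem_homotopic_postcomp[OF assms(1)] abelian_group_stab Y.A.abelian_group_axioms) auto
  then show ?thesis by (simp add: comp_def)
qed

lemma homotopic_stab_mono:
  assumes "homotopic X (stab k Y) f g" "k \<le> l" and Y: "halgebra H Y"
  shows "homotopic X (stab l Y) f g"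
  using assms(1) unfolding homotopic_def
proof (induct rule: equivclp_induct)
  case (step g g')
  then have "elem_homotopic X (stab l Y) g g' \<or> elem_homotopic X (stab l Y) g' g"
    using elem_homotopic_stab_mono[OF _ assms(2) Y] by blast
  then show ?case using step(3) by (blast intro: equivclp_into_equivclp)
qed simp

end


section \<open>Classes of homomorphisms\<close>

lemma stab_corner_eq:
  "stab_corner X x = Mat (\<lambda>i j. Mat (\<lambda>a b. if i = 0 \<and> j = 0 \<and> a = 0 \<and> b = 0 then x else \<zero>\<^bsub>X\<^esub>))"
  by (simp add: stab_corner_def corner_def mat_alg_def fun_eq_iff)

text \<open>
  At the stage without loops the bonding maps are \<open>stab_map (\<lambda>x. x)\<close>, the identity on matrices of
  matrices, though not on all elements of the type.
\<close>

lemma stab_map_id_stab_corner: "stab_map (\<lambda>x. x) (stab_corner X x) = stab_corner X x"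
  by (simp add: stab_map_def mat_map_def stab_corner_eq)

lemma prod_decode_zero_iff: "fst (prod_decode i) = 0 \<and> snd (prod_decode i) = 0 \<longleftrightarrow> i = 0"
proof -
  have "prod_encode (0, 0) = 0" by (simp add: prod_encode_def)
  then show ?thesis by (metis prod_decode_inverse prod_encode_inverse prod.collapse fst_conv snd_conv)
qed

context kk_theory
begin

text \<open>
  Maps that become homotopic in all large matrix algebras have the same class. It is stated as an
  inclusion because the hypotheses are symmetric in \<open>(a, f)\<close> and \<open>(b, g)\<close>.
\<close>

lemma stage_class_subset:
  assumes Y: "halgebra H Y"
    and hom: "\<And>l. \<lbrakk>a \<le> l; b \<le> l\<rbrakk> \<Longrightarrow>
      homotopic X (stab l Y) (stab_map (\<lambda>x. x) \<circ> f) (stab_map (\<lambda>x. x) \<circ> g)"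
  shows "stage_class 0 X Y [a] f \<subseteq> stage_class 0 X Y [b] g"
proof clarify
  fix j f' assume "(j, f') \<in> stage_class 0 X Y [a] f"
  then obtain c l where j: "(j, f') \<in> ind_homs X (stage_ind 0 Y)" "j = [c]" and l: "a \<le> l" "c \<le> l"
    and h: "homotopic X (stab l Y) (stab_map (\<lambda>x. x) \<circ> f) (stab_map (\<lambda>x. x) \<circ> f')"
    by (auto simp: stage_class_def ind_class_def ind_homs_def ind_stab_def ind_spheres_def
        spheres_bond.simps[abs_def])
  \<comment> \<open>The index \<open>l\<close> that witnesses membership in the class of \<open>f\<close> need not be above \<open>b\<close>.\<close>
  let ?l = "max l b"
  have "homotopic X (stab ?l Y) (stab_map (\<lambda>x. x) \<circ> g) (stab_map (\<lambda>x. x) \<circ> f)"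
    using hom[of ?l] l unfolding homotopic_def by (simp add: equivclp_sym)
  moreover have "homotopic X (stab ?l Y) (stab_map (\<lambda>x. x) \<circ> f) (stab_map (\<lambda>x. x) \<circ> f')"
    by (rule homotopic_stab_mono[OF h _ Y]) simp
  ultimately have "homotopic X (stab ?l Y) (stab_map (\<lambda>x. x) \<circ> g) (stab_map (\<lambda>x. x) \<circ> f')"
    unfolding homotopic_def by (rule equivclp_trans)
  then show "(j, f') \<in> stage_class 0 X Y [b] g"
    using j l by (auto simp: stage_class_def ind_class_def ind_stab_def ind_spheres_def
        spheres_bond.simps[abs_def] intro!: exI[of _ "[?l]"])
qed

text \<open>
  The sizes \<open>a\<close> and \<open>b\<close> are independent because a product of classes at size 1 has its
  representative at size \<open>prod_encode (1, 1)\<close>, to be compared with a class at size 1 again.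
\<close>

lemma stage_class_stab_corner:
  assumes fg: "elem_homotopic X Y f g" and X: "halgebra H X" and Y: "halgebra H Y"
    and pos: "0 < a" "0 < b"
    and f': "\<And>x. x \<in> carrier X \<Longrightarrow> f' x = stab_corner Y (f x)"
    and g': "\<And>x. x \<in> carrier X \<Longrightarrow> g' x = stab_corner Y (g x)"
  shows "stage_class 0 X Y [a] f' = stage_class 0 X Y [b] g'"
proof -
  interpret Y: halgebra H Y by fact
  have "homotopic X (stab l Y) (stab_map (\<lambda>x. x) \<circ> f') (stab_map (\<lambda>x. x) \<circ> g')" if "0 < l" for l
  proof -
    have "elem_homotopic X (stab l Y) (stab_corner Y \<circ> f) (stab_corner Y \<circ> g)"
      using fg alg_hom_stab_corner[OF Y that] Y.A.abelian_group_axioms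
        abelian_group_stab[OF Y.A.abelian_group_axioms] Y.mult_closed
      by (rule elem_homotopic_postcomp)
    then have "elem_homotopic X (stab l Y) (stab_map (\<lambda>x. x) \<circ> f') (stab_map (\<lambda>x. x) \<circ> g')"
      by (rule elem_homotopic_cong[OF _ X]) (simp_all add: f' g' stab_map_id_stab_corner)
    then show ?thesis unfolding homotopic_def by blast
  qed
  with pos show ?thesis
    by (intro equalityI stage_class_subset[OF Y]) (auto simp: homotopic_def equivclp_sym)
qed

lemma stab_corner_stage_hom:
  assumes "alg_hom X Y f" "halgebra H Y"
  shows "([1], stab_corner Y \<circ> f) \<in> stage_homs 0 X Y"
  using alg_hom_comp[OF assms(1) alg_hom_stab_corner[OF assms(2)], of 1]
  by (simp add: stage_homs_def ind_homs_def ind_stab_def ind_spheres_def)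

lemma j_class_in_kk:
  assumes "alg_hom X Y f" "halgebra H Y"
  shows "j_class X Y f \<in> kk X Y"
  using stab_corner_stage_hom[OF assms]
  unfolding j_class_def kk_rep_def kk_def stage_def stage_class_def ind_classes_def stage_homs_def
  by blast

text \<open>
  The pair of indices \<open>(0, 0)\<close> has number 0, so that the upper left entry of the upper left entry
  becomes the upper left entry. All other entries vanish, for which \<open>g\<close> has to preserve zero.
\<close>

lemma product_hom_stab_corner:
  assumes "g \<zero>\<^bsub>Y\<^esub> = \<zero>\<^bsub>Z\<^esub>"
  shows "product_hom Y Z 1 [] (stab_corner Z \<circ> g) 1 [] (stab_corner Y \<circ> f) x = stab_corner Z (g (f x))"
proof -
  define u where "u i = fst (prod_decode i)" for i
  define v where "v i = snd (prod_decode i)" for i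
  have uv: "i = 0 \<longleftrightarrow> u i = 0 \<and> v i = 0" for i
    by (simp only: u_def v_def prod_decode_zero_iff)
  have entry_eq: "(if v i = 0 \<and> v j = 0 \<and> v a = 0 \<and> v b = 0
        then g (if u i = 0 \<and> u j = 0 \<and> u a = 0 \<and> u b = 0 then y else \<zero>\<^bsub>Y\<^esub>) else \<zero>\<^bsub>Z\<^esub>)
      = (if i = 0 \<and> j = 0 \<and> a = 0 \<and> b = 0 then g y else \<zero>\<^bsub>Z\<^esub>)" for i j a b y
    unfolding uv[of i] uv[of j] uv[of a] uv[of b] by (simp add: assms)
  have "product_hom Y Z 1 [] (stab_corner Z \<circ> g) 1 [] (stab_corner Y \<circ> f) x
      = Mat (\<lambda>i j. Mat (\<lambda>a b. if v i = 0 \<and> v j = 0 \<and> v a = 0 \<and> v b = 0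
          then g (if u i = 0 \<and> u j = 0 \<and> u a = 0 \<and> u b = 0 then f x else \<zero>\<^bsub>Y\<^esub>) else \<zero>\<^bsub>Z\<^esub>))"
    unfolding u_def v_def
    by (simp add: product_hom_def mat_combine_def stab_map_def mat_map_def swap_stab_def stab_corner_eq)
  then show ?thesis
    by (simp only: entry_eq stab_corner_eq)
qed

text \<open>
  With \<open>h = g \<circ> f\<close> this says that \<open>j\<close> is a functor; in general it also contains the invariance of
  \<open>j\<close> under homotopy.
\<close>

lemma kk_product_j_class:
  assumes f: "alg_hom X Y f" and g: "alg_hom Y Z g" and h: "elem_homotopic X Z (g \<circ> f) h"
    and X: "halgebra H X" and Y: "halgebra H Y" and Z: "halgebra H Z"
  shows "kk_product X Y Z (j_class Y Z g) (j_class X Y f) (j_class X Z h)"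
proof -
  interpret Y: halgebra H Y by fact
  interpret Z: halgebra H Z by fact
  have zero: "g \<zero>\<^bsub>Y\<^esub> = \<zero>\<^bsub>Z\<^esub>"
    by (rule alg_hom_zero[OF g Y.A.abelian_group_axioms Z.A.abelian_group_axioms])
  have "stage_class 0 X Z [prod_encode (1, 1)]
      (product_hom Y Z 1 [] (stab_corner Z \<circ> g) 1 [] (stab_corner Y \<circ> f))
    = stage_class 0 X Z [1] (stab_corner Z \<circ> h)"
    by (rule stage_class_stab_corner[OF h X Z])
      (simp_all add: product_hom_stab_corner[where g = g, OF zero, unfolded One_nat_def] prod_encode_def)
  then have "j_class X Z h = kk_rep X Z (0 + 0) (prod_encode (1, 1) # [] @ [])
      (product_hom Y Z 1 [] (stab_corner Z \<circ> g) 1 [] (stab_corner Y \<circ> f))"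
    by (simp add: j_class_def kk_rep_def)
  then show ?thesis
    unfolding kk_product_def
    using stab_corner_stage_hom[OF f Y] stab_corner_stage_hom[OF g Z]
    by (intro exI[of _ 0] exI[of _ 1] exI[of _ "[]"] exI[of _ "stab_corner Z \<circ> g"]
        exI[of _ "stab_corner Y \<circ> f"]) (simp add: j_class_def Let_def)
qed

lemma kk_equivalence_homotopy_inverse:
  assumes f: "alg_hom X Y f" and g: "alg_hom Y X g"
    and gf: "elem_homotopic X X (g \<circ> f) (\<lambda>x. x)" and fg: "elem_homotopic Y Y (f \<circ> g) (\<lambda>x. x)"
    and X: "halgebra H X" and Y: "halgebra H Y"
  shows "kk_equivalence X Y f"
  unfolding kk_equivalence_def
  using f j_class_in_kk[OF g X] kk_product_j_class[OF f g gf X Y X] kk_product_j_class[OF g f fg Y X Y]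
  by blast

text \<open>
  The homotopy is \<open>x \<mapsto> \<Sum>\<^sub>n x\<^sub>n t\<^sup>n\<close>.
\<close>

lemma graded_elem_homotopic:
  assumes "nat_graded_halgebra H A G"
  shows "elem_homotopic A A (\<lambda>x. nat_graded_halgebra.component A G x 0) (\<lambda>x. x)"
proof -
  interpret A: nat_graded_halgebra H A G by fact
  let ?h = "\<lambda>x. Poly (A.component x)"
  have "alg_hom A (poly_alg A) ?h"
    unfolding alg_hom_def
    by (auto simp: poly_alg_def A.component_closed A.finite_components A.component_add
        A.component_mult A.component_lact A.component_ract)
  moreover have "ev0 (?h x) = A.component x 0" "ev1 A (?h x) = x" if "x \<in> carrier A" for x
    using that by (simp_all add: ev0_def ev1_def A.sum_components)
  moreover have "alg_hom A A (\<lambda>x. A.component x 0)"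
    unfolding alg_hom_def
    by (auto simp: A.component_closed A.component_add A.component_mult A.mult_closed
        A.component_lact A.component_ract)
  ultimately show ?thesis
    unfolding elem_homotopic_def by (intro conjI exI[of _ ?h]) (auto simp: alg_hom_def)
qed

end

theorem theorem7p2p1:
  fixes H :: "('h, 'm) ring_scheme" and central :: bool and U :: underlying
    and A :: "('h, 'a) alg" and G :: "nat \<Rightarrow> ('h, 'a) univ set"
  assumes "kk_theory H central"
    and "kk_theory.is_alg H central A"
    and "nat_graded_halgebra H A G"
  shows "kk_theory.kk_equivalence H central U (A\<lparr>carrier := G 0\<rparr>) A (\<lambda>x. x)"
proof -
  interpret kk_theory H central U by (rule assms(1))
  interpret A: nat_graded_halgebra H A G by (rule assms(3))
  let ?A0 = "A\<lparr>carrier := G 0\<rparr>" and ?p = "\<lambda>x. A.component x 0"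
  have incl: "alg_hom ?A0 A (\<lambda>x. x)"
    by (auto simp: alg_hom_def A.degree_closed)
  have proj: "alg_hom A ?A0 ?p"
    unfolding alg_hom_def
    by (auto simp: A.component_degree A.component_closed A.component_add A.component_mult A.mult_closed
        A.component_lact A.component_ract)
  have "elem_homotopic ?A0 ?A0 (?p \<circ> (\<lambda>x. x)) (?p \<circ> (\<lambda>x. x))"
    using alg_hom_comp[OF incl proj] A.halgebra_degree_zero by (rule elem_homotopic_refl)
  then have "elem_homotopic ?A0 ?A0 (?p \<circ> (\<lambda>x. x)) (\<lambda>x. x)"
    by (rule elem_homotopic_cong[OF _ A.halgebra_degree_zero]) (simp_all add: A.component_homogeneous)
  moreover have "elem_homotopic A A ((\<lambda>x. x) \<circ> ?p) (\<lambda>x. x)"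
    using graded_elem_homotopic[OF assms(3)] by (simp add: comp_def)
  ultimately show ?thesis
    by (intro kk_equivalence_homotopy_inverse[OF incl proj] A.halgebra_degree_zero A.halgebra_axioms)
qed

end
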